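(* The arithmetical theory $R^\backsim$ is essentially undecidable in the first-order logic $\mathrm{QL}_0$; that is, $R^\backsim$ is $\Sigma_1$-consistent in $\mathrm{QL}_0$, and every theory $T$ (in the arithmetical language) that is $\Sigma_1$-consistent in $\mathrm{QL}_0$ and strengthens $R^\backsim$ in $\mathrm{QL}_0$ is undecidable in $\mathrm{QL}_0$.
   Context: Propositional logic $\mathrm{L}_0$: the language has binary connectives $\to,\wedge,\vee$ and a constant $\bot$; $\neg\varphi:=\varphi\to\bot$ and $\varphi\leftrightarrow\psi:=(\varphi\to\psi)\wedge(\psi\to\varphi)$. $\mathrm{L}_0$ is given by the Hilbert system with axioms $\varphi\to\varphi$; $\varphi\wedge\psi\to\varphi$; $\varphi\wedge\psi\to\psi$; $\varphi\to\varphi\vee\psi$; $\psi\to\varphi\vee\psi$; and rules (premises $\rhd$ conclusion): $\varphi\rhd\psi\to\varphi$; $\varphi,\varphi\to\psi\rhd\psi$; $\varphi\rhd(\varphi\to\psi)\to\psi$; $\varphi\to\psi,\psi\to\chi\rhd\varphi\to\chi$; $\neg\varphi\vee\neg\psi\rhd\neg(\varphi\wedge\psi)$; $\chi\to\varphi,\chi\to\psi\rhd\chi\to\varphi\wedge\psi$; $\varphi\to\chi,\psi\to\chi\rhd\varphi\vee\psi\to\chi$. (No axiom $\bot\to\varphi$.) First-order logic $\mathrm{QL}_0$: over a first-order language with equality $=$ (write $t\neq s$ for $\neg(t=s)$), axiomatised by all substitution instances (atoms replaced by first-order formulas) of the axioms and rules of $\mathrm{L}_0$ together with: $(\forall x)\varphi(x)\to\varphi(t)$;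 $\varphi(t)\to(\exists x)\varphi(x)$; $\chi\to\psi\rhd\chi\to(\forall x)\psi$; $\psi\to\chi\rhd(\exists x)\psi\to\chi$ (for $t$ substitutable for $x$ and $x$ not free in $\chi$); $x=x$; $x=y\to y=x$; $x=y\to(y=z\to x=z)$; $x=y\to t(x)=t(y)$; $x=y\to(\varphi(x)\to\varphi(y))$. Arithmetical language: constant $\overline{0}$, unary function $S$, binary predicates $=$ and $\leq$, ternary predicates $A$ and $M$. Numerals: $\overline{n}=S\cdots S(\overline{0})$ ($n$ times $S$). Bounded quantifiers: $(\forall x\leq y)\varphi:=(\forall x)(\neg(x\leq y)\vee\varphi)$, $(\exists x\leq y)\varphi:=(\exists x)(x\leq y\wedge\varphi)$. $\Delta_0$-formulas are those all of whose quantifiers are bounded; $\Sigma_1$-formulas are those of the form $(\exists x)\psi$ with $\psi$ a $\Delta_0$-formula; the negation of a $\Sigma_1$-formula $\varphi$ is $\neg\varphi$. $R^\backsim$ is the theory with axioms: $A(\overline{m},\overline{n},x)\leftrightarrow\overline{m+n}=x$ and $M(\overline{m},\overline{n},x)\leftrightarrow\overline{m\cdot n}=x$ for all $m,n$; $\overline{m}\neq\overline{n}$ for $m\neq n$; $x\leq\overline{n}\leftrightarrow(x=\overline{0}\vee x=\overline{1}\vee\dots\vee x=\overline{n})$, $x\leq\overline{n}\vee\overline{n}\leq x$, and $x\leq\overline{n}\vee\neg(x\leq\overline{n})$ for all $n$. Abstract notions for a logic $\mathfrak{L}$ (consequence relation $\vdash_\mathfrak{L}$): $C_\mathfrak{L}(T)=\{\varphi\mid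 T\vdash_\mathfrak{L}\varphi\}$; $T$ is decidable in $\mathfrak{L}$ if $C_\mathfrak{L}(T)$ is recursive (w.r.t. a standard coding of formulas); $T$ strengthens $S$ in $\mathfrak{L}$ if $S\subseteq C_\mathfrak{L}(T)$; $T$ is $\Sigma_1$-consistent in $\mathfrak{L}$ if there is no $\Sigma_1$-formula $\varphi$ with $T\vdash_\mathfrak{L}\varphi$ and $T\vdash_\mathfrak{L}\neg\varphi$; $T$ is essentially undecidable in $\mathfrak{L}$ if it is consistent and each consistent theory strengthening it is undecidable. *)

theory Defs
  imports Main "HOL-Library.Nat_Bijection"
begin

section \<open>The arithmetical language\<close>

datatype tm = Var nat | Zero | S tm

text \<open>\<open>Add\<close> and \<open>Mul\<close> are the ternary predicates \<open>A\<close> and \<open>M\<close>.\<close>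

datatype fm =
    Eq tm tm
  | Le tm tm
  | Add tm tm tm
  | Mul tm tm tm
  | Bot
  | Imp fm fm
  | And fm fm
  | Or fm fm
  | All nat fm
  | Ex nat fm

abbreviation Neg :: "fm \<Rightarrow> fm" where
  "Neg \<phi> \<equiv> Imp \<phi> Bot"

abbreviation Iff :: "fm \<Rightarrow> fm \<Rightarrow> fm" where
  "Iff \<phi> \<psi> \<equiv> And (Imp \<phi> \<psi>) (Imp \<psi> \<phi>)"

abbreviation Neq :: "tm \<Rightarrow> tm \<Rightarrow> fm" where
  "Neq s t \<equiv> Neg (Eq s t)"

primrec numeral_tm :: "nat \<Rightarrow> tm" where
  "numeral_tm 0 = Zero"
| "numeral_tm (Suc n) = S (numeral_tm n)"

primrec vars_tm :: "tm \<Rightarrow> nat set" where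
  "vars_tm (Var x) = {x}"
| "vars_tm Zero = {}"
| "vars_tm (S t) = vars_tm t"

primrec free_vars :: "fm \<Rightarrow> nat set" where
  "free_vars (Eq s t) = vars_tm s \<union> vars_tm t"
| "free_vars (Le s t) = vars_tm s \<union> vars_tm t"
| "free_vars (Add r s t) = vars_tm r \<union> vars_tm s \<union> vars_tm t"
| "free_vars (Mul r s t) = vars_tm r \<union> vars_tm s \<union> vars_tm t"
| "free_vars Bot = {}"
| "free_vars (Imp \<phi> \<psi>) = free_vars \<phi> \<union> free_vars \<psi>"
| "free_vars (And \<phi> \<psi>) = free_vars \<phi> \<union> free_vars \<psi>"
| "free_vars (Or \<phi> \<psi>) = free_vars \<phi> \<union> free_vars \<psi>"
| "free_vars (All y \<phi>) = free_vars \<phi> - {y}"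
| "free_vars (Ex y \<phi>) = free_vars \<phi> - {y}"

primrec subst_tm :: "tm \<Rightarrow> nat \<Rightarrow> tm \<Rightarrow> tm" where
  "subst_tm (Var y) x u = (if y = x then u else Var y)"
| "subst_tm Zero x u = Zero"
| "subst_tm (S t) x u = S (subst_tm t x u)"

text \<open>Replacement of the free occurrences of \<open>x\<close> by \<open>u\<close>; bound variables are not renamed, so this is
  used only under the side condition \<open>substitutable\<close>.\<close>

primrec subst :: "fm \<Rightarrow> nat \<Rightarrow> tm \<Rightarrow> fm" where
  "subst (Eq s t) x u = Eq (subst_tm s x u) (subst_tm t x u)"
| "subst (Le s t) x u = Le (subst_tm s x u) (subst_tm t x u)"
| "subst (Add r s t) x u = Add (subst_tm r x u) (subst_tm s x u) (subst_tm t x u)"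
| "subst (Mul r s t) x u = Mul (subst_tm r x u) (subst_tm s x u) (subst_tm t x u)"
| "subst Bot x u = Bot"
| "subst (Imp \<phi> \<psi>) x u = Imp (subst \<phi> x u) (subst \<psi> x u)"
| "subst (And \<phi> \<psi>) x u = And (subst \<phi> x u) (subst \<psi> x u)"
| "subst (Or \<phi> \<psi>) x u = Or (subst \<phi> x u) (subst \<psi> x u)"
| "subst (All y \<phi>) x u = (if y = x then All y \<phi> else All y (subst \<phi> x u))"
| "subst (Ex y \<phi>) x u = (if y = x then Ex y \<phi> else Ex y (subst \<phi> x u))"

primrec substitutable :: "tm \<Rightarrow> nat \<Rightarrow> fm \<Rightarrow> bool" where
  "substitutable u x (Eq s t) \<longleftrightarrow> True"
| "substitutable u x (Le s t) \<longleftrightarrow> True"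
| "substitutable u x (Add r s t) \<longleftrightarrow> True"
| "substitutable u x (Mul r s t) \<longleftrightarrow> True"
| "substitutable u x Bot \<longleftrightarrow> True"
| "substitutable u x (Imp \<phi> \<psi>) \<longleftrightarrow> substitutable u x \<phi> \<and> substitutable u x \<psi>"
| "substitutable u x (And \<phi> \<psi>) \<longleftrightarrow> substitutable u x \<phi> \<and> substitutable u x \<psi>"
| "substitutable u x (Or \<phi> \<psi>) \<longleftrightarrow> substitutable u x \<phi> \<and> substitutable u x \<psi>"
| "substitutable u x (All y \<phi>) \<longleftrightarrow>
     x \<notin> free_vars (All y \<phi>) \<or> (y \<notin> vars_tm u \<and> substitutable u x \<phi>)"
| "substitutable u x (Ex y \<phi>) \<longleftrightarrow>
     x \<notin> free_vars (Ex y \<phi>) \<or> (y \<notin> vars_tm u \<and> substitutable u x \<phi>)"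


section \<open>The logic \<open>QL\<^sub>0\<close> over the arithmetical language\<close>

text \<open>Theories are arbitrary sets of possibly open formulas. In schemata displaying \<open>\<phi>(x)\<close> and
  \<open>\<phi>(t)\<close>, \<open>\<phi>(x)\<close> is \<open>\<phi>\<close> and \<open>\<phi>(t)\<close> is the result of substituting \<open>t\<close> for all free occurrences
  of \<open>x\<close>.\<close>

inductive ql0 :: "fm set \<Rightarrow> fm \<Rightarrow> bool" (infix "\<turnstile>" 50) for T :: "fm set" where
  assumption: "\<phi> \<in> T \<Longrightarrow> T \<turnstile> \<phi>"
| imp_refl: "T \<turnstile> Imp \<phi> \<phi>"
| and_left: "T \<turnstile> Imp (And \<phi> \<psi>) \<phi>"
| and_right: "T \<turnstile> Imp (And \<phi> \<psi>) \<psi>"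
| or_left: "T \<turnstile> Imp \<phi> (Or \<phi> \<psi>)"
| or_right: "T \<turnstile> Imp \<psi> (Or \<phi> \<psi>)"
| weakening: "T \<turnstile> \<phi> \<Longrightarrow> T \<turnstile> Imp \<psi> \<phi>"
| modus_ponens: "T \<turnstile> \<phi> \<Longrightarrow> T \<turnstile> Imp \<phi> \<psi> \<Longrightarrow> T \<turnstile> \<psi>"
| assertion: "T \<turnstile> \<phi> \<Longrightarrow> T \<turnstile> Imp (Imp \<phi> \<psi>) \<psi>"
| transitivity: "T \<turnstile> Imp \<phi> \<psi> \<Longrightarrow> T \<turnstile> Imp \<psi> \<chi> \<Longrightarrow> T \<turnstile> Imp \<phi> \<chi>"
| de_morgan: "T \<turnstile> Or (Neg \<phi>) (Neg \<psi>) \<Longrightarrow> T \<turnstile> Neg (And \<phi> \<psi>)"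
| and_intro: "T \<turnstile> Imp \<chi> \<phi> \<Longrightarrow> T \<turnstile> Imp \<chi> \<psi> \<Longrightarrow> T \<turnstile> Imp \<chi> (And \<phi> \<psi>)"
| or_elim: "T \<turnstile> Imp \<phi> \<chi> \<Longrightarrow> T \<turnstile> Imp \<psi> \<chi> \<Longrightarrow> T \<turnstile> Imp (Or \<phi> \<psi>) \<chi>"
| all_inst: "substitutable t x \<phi> \<Longrightarrow> T \<turnstile> Imp (All x \<phi>) (subst \<phi> x t)"
| ex_inst: "substitutable t x \<phi> \<Longrightarrow> T \<turnstile> Imp (subst \<phi> x t) (Ex x \<phi>)"
| all_gen: "T \<turnstile> Imp \<chi> \<psi> \<Longrightarrow> x \<notin> free_vars \<chi> \<Longrightarrow> T \<turnstile> Imp \<chi> (All x \<psi>)"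
| ex_gen: "T \<turnstile> Imp \<psi> \<chi> \<Longrightarrow> x \<notin> free_vars \<chi> \<Longrightarrow> T \<turnstile> Imp (Ex x \<psi>) \<chi>"
| eq_refl: "T \<turnstile> Eq (Var x) (Var x)"
| eq_sym: "T \<turnstile> Imp (Eq (Var x) (Var y)) (Eq (Var y) (Var x))"
| eq_trans: "T \<turnstile> Imp (Eq (Var x) (Var y)) (Imp (Eq (Var y) (Var z)) (Eq (Var x) (Var z)))"
| eq_tm: "T \<turnstile> Imp (Eq (Var x) (Var y)) (Eq t (subst_tm t x (Var y)))"
| eq_fm: "substitutable (Var y) x \<phi> \<Longrightarrow>
    T \<turnstile> Imp (Eq (Var x) (Var y)) (Imp \<phi> (subst \<phi> x (Var y)))"

definition consequences :: "fm set \<Rightarrow> fm set" where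
  "consequences T = {\<phi>. T \<turnstile> \<phi>}"

definition strengthens :: "fm set \<Rightarrow> fm set \<Rightarrow> bool" where
  "strengthens T U \<longleftrightarrow> U \<subseteq> consequences T"


section \<open>\<open>\<Delta>\<^sub>0\<close>- and \<open>\<Sigma>\<^sub>1\<close>-formulas\<close>

abbreviation BAll :: "nat \<Rightarrow> nat \<Rightarrow> fm \<Rightarrow> fm" where
  "BAll x y \<phi> \<equiv> All x (Or (Neg (Le (Var x) (Var y))) \<phi>)"

abbreviation BEx :: "nat \<Rightarrow> nat \<Rightarrow> fm \<Rightarrow> fm" where
  "BEx x y \<phi> \<equiv> Ex x (And (Le (Var x) (Var y)) \<phi>)"

text \<open>Without \<open>x \<noteq> y\<close> the bound would be captured by the quantifier, and \<open>BAll\<close> and \<open>BEx\<close> would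
  not bound anything.\<close>

inductive delta0 :: "fm \<Rightarrow> bool" where
  "delta0 (Eq s t)"
| "delta0 (Le s t)"
| "delta0 (Add r s t)"
| "delta0 (Mul r s t)"
| "delta0 Bot"
| "delta0 \<phi> \<Longrightarrow> delta0 \<psi> \<Longrightarrow> delta0 (Imp \<phi> \<psi>)"
| "delta0 \<phi> \<Longrightarrow> delta0 \<psi> \<Longrightarrow> delta0 (And \<phi> \<psi>)"
| "delta0 \<phi> \<Longrightarrow> delta0 \<psi> \<Longrightarrow> delta0 (Or \<phi> \<psi>)"
| "delta0 \<phi> \<Longrightarrow> x \<noteq> y \<Longrightarrow> delta0 (BAll x y \<phi>)"
| "delta0 \<phi> \<Longrightarrow> x \<noteq> y \<Longrightarrow> delta0 (BEx x y \<phi>)"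

definition sigma1 :: "fm \<Rightarrow> bool" where
  "sigma1 \<phi> \<longleftrightarrow> (\<exists>x \<psi>. delta0 \<psi> \<and> \<phi> = Ex x \<psi>)"

definition sigma1_consistent :: "fm set \<Rightarrow> bool" where
  "sigma1_consistent T \<longleftrightarrow> \<not> (\<exists>\<phi>. sigma1 \<phi> \<and> T \<turnstile> \<phi> \<and> T \<turnstile> Neg \<phi>)"


section \<open>The theory \<open>R\<^sup>\<sim>\<close>\<close>

primrec eq_some_upto :: "tm \<Rightarrow> nat \<Rightarrow> fm" where
  "eq_some_upto t 0 = Eq t (numeral_tm 0)"
| "eq_some_upto t (Suc n) = Or (eq_some_upto t n) (Eq t (numeral_tm (Suc n)))"

inductive_set R_tilde :: "fm set" where
  add: "Iff (Add (numeral_tm m) (numeral_tm n) (Var x)) (Eq (numeral_tm (m + n)) (Var x)) \<in> R_tilde"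
| mul: "Iff (Mul (numeral_tm m) (numeral_tm n) (Var x)) (Eq (numeral_tm (m * n)) (Var x)) \<in> R_tilde"
| neq: "m \<noteq> n \<Longrightarrow> Neq (numeral_tm m) (numeral_tm n) \<in> R_tilde"
| le: "Iff (Le (Var x) (numeral_tm n)) (eq_some_upto (Var x) n) \<in> R_tilde"
| le_linear: "Or (Le (Var x) (numeral_tm n)) (Le (numeral_tm n) (Var x)) \<in> R_tilde"
| le_decide: "Or (Le (Var x) (numeral_tm n)) (Neg (Le (Var x) (numeral_tm n))) \<in> R_tilde"


section \<open>Recursive sets and decidability\<close>

text \<open>\<open>rec_fun n f\<close>: \<open>f\<close>, restricted to lists of length \<open>n\<close>, is an \<open>n\<close>-ary total recursive function
  (values on lists of other lengths are irrelevant). Minimisation is applied to regular functions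
  only, so that all functions generated are total.\<close>

inductive rec_fun :: "nat \<Rightarrow> (nat list \<Rightarrow> nat) \<Rightarrow> bool" where
  zero: "rec_fun n (\<lambda>xs. 0)"
| succ: "rec_fun 1 (\<lambda>xs. Suc (xs ! 0))"
| proj: "i < n \<Longrightarrow> rec_fun n (\<lambda>xs. xs ! i)"
| comp: "rec_fun (length gs) f \<Longrightarrow> \<forall>g \<in> set gs. rec_fun n g \<Longrightarrow>
    rec_fun n (\<lambda>xs. f (map (\<lambda>g. g xs) gs))"
| prim_rec: "rec_fun n f \<Longrightarrow> rec_fun (n + 2) g \<Longrightarrow>
    rec_fun (n + 1) (\<lambda>xs. rec_nat (f (tl xs)) (\<lambda>k r. g (k # r # tl xs)) (hd xs))"
| minimisation: "rec_fun (n + 1) f \<Longrightarrow> \<forall>xs. length xs = n \<longrightarrow> (\<exists>k. f (k # xs) = 0) \<Longrightarrow>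
    rec_fun n (\<lambda>xs. LEAST k. f (k # xs) = 0)"

definition recursive_set :: "nat set \<Rightarrow> bool" where
  "recursive_set X \<longleftrightarrow> (\<exists>f. rec_fun 1 f \<and> (\<forall>n. f [n] = (if n \<in> X then 1 else 0)))"

primrec tm_code :: "tm \<Rightarrow> nat" where
  "tm_code (Var x) = prod_encode (0, x)"
| "tm_code Zero = prod_encode (1, 0)"
| "tm_code (S t) = prod_encode (2, tm_code t)"

primrec fm_code :: "fm \<Rightarrow> nat" where
  "fm_code (Eq s t) = prod_encode (0, prod_encode (tm_code s, tm_code t))"
| "fm_code (Le s t) = prod_encode (1, prod_encode (tm_code s, tm_code t))"
| "fm_code (Add r s t) =
     prod_encode (2, prod_encode (tm_code r, prod_encode (tm_code s, tm_code t)))"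
| "fm_code (Mul r s t) =
     prod_encode (3, prod_encode (tm_code r, prod_encode (tm_code s, tm_code t)))"
| "fm_code Bot = prod_encode (4, 0)"
| "fm_code (Imp \<phi> \<psi>) = prod_encode (5, prod_encode (fm_code \<phi>, fm_code \<psi>))"
| "fm_code (And \<phi> \<psi>) = prod_encode (6, prod_encode (fm_code \<phi>, fm_code \<psi>))"
| "fm_code (Or \<phi> \<psi>) = prod_encode (7, prod_encode (fm_code \<phi>, fm_code \<psi>))"
| "fm_code (All x \<phi>) = prod_encode (8, prod_encode (x, fm_code \<phi>))"
| "fm_code (Ex x \<phi>) = prod_encode (9, prod_encode (x, fm_code \<phi>))"

lemma tm_code_eq_iff [simp]: "tm_code s = tm_code t \<longleftrightarrow> s = t"
proof (induction s arbitrary: t)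
  case (Var x) then show ?case by (cases t) auto
next
  case Zero then show ?case by (cases t) auto
next
  case (S s) then show ?case by (cases t) auto
qed

lemma fm_code_eq_iff [simp]: "fm_code \<phi> = fm_code \<psi> \<longleftrightarrow> \<phi> = \<psi>"
proof (induction \<phi> arbitrary: \<psi>)
  case (Eq s t) then show ?case by (cases \<psi>) auto
next
  case (Le s t) then show ?case by (cases \<psi>) auto
next
  case (Add r s t) then show ?case by (cases \<psi>) auto
next
  case (Mul r s t) then show ?case by (cases \<psi>) auto
next
  case Bot then show ?case by (cases \<psi>) auto
next
  case (Imp \<phi>1 \<phi>2) then show ?case by (cases \<psi>) auto
next
  case (And \<phi>1 \<phi>2) then show ?case by (cases \<psi>) auto
next
  case (Or \<phi>1 \<phi>2) then show ?case by (cases \<psi>) auto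
next
  case (All x \<phi>) then show ?case by (cases \<psi>) auto
next
  case (Ex x \<phi>) then show ?case by (cases \<psi>) auto
qed

definition decidable_theory :: "fm set \<Rightarrow> bool" where
  "decidable_theory T \<longleftrightarrow> recursive_set (fm_code ` consequences T)"

end

theory Submission imports Defs "HOL-Number_Theory.Cong" begin

text \<open>
  Consistency is soundness in the standard model. For undecidability, suppose that \<open>T\<close> is decidable.
  Then a diagonal argument needs, for two disjoint \<open>\<Sigma>\<^sub>1\<close>-sets \<open>\<exists>y P(x, y)\<close> and \<open>\<exists>z Q(x, z)\<close> with \<open>P\<close> and
  \<open>Q\<close> in \<open>\<Delta>\<^sub>0\<close>, a \<open>\<Sigma>\<^sub>1\<close>-formula that is provable on the first set and refutable on the second.
  With Rosser's formula \<open>\<exists>y (P(x, y) \<and> \<forall>z\<le>y \<not>Q(x, z))\<close> one would need the nested implication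
  \<open>q \<le> y \<rightarrow> \<not>\<forall>z\<le>y \<not>Q(n, z)\<close>, which the logic gives no means to derive from \<open>Q(n, q)\<close>. Instead, take the
  formula \<open>\<exists>y \<not>(\<exists>z\<le>y Q(x, z) \<or> \<not>P(x, y))\<close>: if \<open>Q(n, q)\<close> holds, then the disjunction itself is
  provable for a variable \<open>y\<close>, from its second disjunct if \<open>y \<le> q\<close> and from its first if \<open>q \<le> y\<close>, and a
  provable formula has a provable double negation.
\<close>

section \<open>The standard model\<close>

primrec tm_val :: "(nat \<Rightarrow> nat) \<Rightarrow> tm \<Rightarrow> nat" where
  "tm_val e (Var x) = e x"
| "tm_val e Zero = 0"
| "tm_val e (S t) = Suc (tm_val e t)"

primrec sat :: "(nat \<Rightarrow> nat) \<Rightarrow> fm \<Rightarrow> bool" where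
  "sat e (Eq s t) \<longleftrightarrow> tm_val e s = tm_val e t"
| "sat e (Le s t) \<longleftrightarrow> tm_val e s \<le> tm_val e t"
| "sat e (Add r s t) \<longleftrightarrow> tm_val e r + tm_val e s = tm_val e t"
| "sat e (Mul r s t) \<longleftrightarrow> tm_val e r * tm_val e s = tm_val e t"
| "sat e Bot \<longleftrightarrow> False"
| "sat e (Imp \<phi> \<psi>) \<longleftrightarrow> (sat e \<phi> \<longrightarrow> sat e \<psi>)"
| "sat e (And \<phi> \<psi>) \<longleftrightarrow> sat e \<phi> \<and> sat e \<psi>"
| "sat e (Or \<phi> \<psi>) \<longleftrightarrow> sat e \<phi> \<or> sat e \<psi>"
| "sat e (All x \<phi>) \<longleftrightarrow> (\<forall>n. sat (e(x := n)) \<phi>)"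
| "sat e (Ex x \<phi>) \<longleftrightarrow> (\<exists>n. sat (e(x := n)) \<phi>)"

section \<open>Coincidence, substitution and soundness\<close>

lemma tm_val_cong: "(\<And>x. x \<in> vars_tm t \<Longrightarrow> e x = e' x) \<Longrightarrow> tm_val e t = tm_val e' t"
  by (induction t) auto

lemma sat_cong: "(\<And>x. x \<in> free_vars \<phi> \<Longrightarrow> e x = e' x) \<Longrightarrow> sat e \<phi> \<longleftrightarrow> sat e' \<phi>"
proof (induction \<phi> arbitrary: e e')
  case (Eq s t)
  then show ?case using tm_val_cong[of s e e'] tm_val_cong[of t e e'] by simp
next
  case (Le s t)
  then show ?case using tm_val_cong[of s e e'] tm_val_cong[of t e e'] by simp
next
  case (Add r s t)
  then show ?case
    using tm_val_cong[of r e e'] tm_val_cong[of s e e'] tm_val_cong[of t e e'] by simp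
next
  case (Mul r s t)
  then show ?case
    using tm_val_cong[of r e e'] tm_val_cong[of s e e'] tm_val_cong[of t e e'] by simp
next
  case (Imp \<phi> \<psi>)
  have "sat e \<phi> \<longleftrightarrow> sat e' \<phi>" "sat e \<psi> \<longleftrightarrow> sat e' \<psi>"
    by (rule Imp.IH; simp add: Imp.prems)+
  then show ?case by simp
next
  case (And \<phi> \<psi>)
  have "sat e \<phi> \<longleftrightarrow> sat e' \<phi>" "sat e \<psi> \<longleftrightarrow> sat e' \<psi>"
    by (rule And.IH; simp add: And.prems)+
  then show ?case by simp
next
  case (Or \<phi> \<psi>)
  have "sat e \<phi> \<longleftrightarrow> sat e' \<phi>" "sat e \<psi> \<longleftrightarrow> sat e' \<psi>"
    by (rule Or.IH; simp add: Or.prems)+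
  then show ?case by simp
next
  case (All y \<phi>)
  have "sat (e(y := n)) \<phi> \<longleftrightarrow> sat (e'(y := n)) \<phi>" for n
    by (rule All.IH) (use All.prems in auto)
  then show ?case by simp
next
  case (Ex y \<phi>)
  have "sat (e(y := n)) \<phi> \<longleftrightarrow> sat (e'(y := n)) \<phi>" for n
    by (rule Ex.IH) (use Ex.prems in auto)
  then show ?case by simp
qed simp

lemma tm_val_upd: "x \<notin> vars_tm t \<Longrightarrow> tm_val (e(x := n)) t = tm_val e t"
  by (rule tm_val_cong) auto

lemma sat_upd: "x \<notin> free_vars \<phi> \<Longrightarrow> sat (e(x := n)) \<phi> \<longleftrightarrow> sat e \<phi>"
  by (rule sat_cong) auto

lemma tm_val_subst [simp]: "tm_val e (subst_tm t x u) = tm_val (e(x := tm_val e u)) t"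
  by (induction t) auto

lemma subst_tm_notin: "x \<notin> vars_tm t \<Longrightarrow> subst_tm t x u = t"
  by (induction t) auto

lemma subst_notin: "x \<notin> free_vars \<phi> \<Longrightarrow> subst \<phi> x u = \<phi>"
  by (induction \<phi>) (auto simp: subst_tm_notin)

lemma sat_subst:
  "substitutable u x \<phi> \<Longrightarrow> sat e (subst \<phi> x u) \<longleftrightarrow> sat (e(x := tm_val e u)) \<phi>"
proof (induction \<phi> arbitrary: e)
  case (All y \<phi>)
  show ?case
  proof (cases "x \<in> free_vars (All y \<phi>)")
    case True
    with All.prems have y: "y \<noteq> x" "y \<notin> vars_tm u" "substitutable u x \<phi>" by auto
    have "sat (e(y := n)) (subst \<phi> x u) \<longleftrightarrow> sat ((e(x := tm_val e u))(y := n)) \<phi>" for n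
      using All.IH[OF y(3)] tm_val_upd[OF y(2)] fun_upd_twist[OF y(1)] by metis
    then show ?thesis using y by (simp add: fun_upd_def)
  next
    case False
    then show ?thesis by (metis sat_upd subst_notin)
  qed
next
  case (Ex y \<phi>)
  show ?case
  proof (cases "x \<in> free_vars (Ex y \<phi>)")
    case True
    with Ex.prems have y: "y \<noteq> x" "y \<notin> vars_tm u" "substitutable u x \<phi>" by auto
    have "sat (e(y := n)) (subst \<phi> x u) \<longleftrightarrow> sat ((e(x := tm_val e u))(y := n)) \<phi>" for n
      using Ex.IH[OF y(3)] tm_val_upd[OF y(2)] fun_upd_twist[OF y(1)] by metis
    then show ?thesis using y by (simp add: fun_upd_def)
  next
    case False
    then show ?thesis by (metis sat_upd subst_notin)
  qed
qed auto

text \<open>All axioms and rules are classically valid. Members of \<open>T\<close> are taken to be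
  true under every assignment because open ones are subject to generalisation.\<close>

lemma soundness:
  assumes "T \<turnstile> \<phi>" and "\<And>e \<psi>. \<psi> \<in> T \<Longrightarrow> sat e \<psi>"
  shows "sat e \<phi>"
  using assms(1)
proof (induction arbitrary: e rule: ql0.induct)
  case (all_gen \<chi> \<psi> x)
  then show ?case by (metis sat.simps(6) sat.simps(9) sat_upd)
next
  case (ex_gen \<psi> \<chi> x)
  then show ?case by (metis sat.simps(6) sat.simps(10) sat_upd)
next
  case (all_inst t x \<phi>)
  then show ?case by (simp add: sat_subst)
next
  case (ex_inst t x \<phi>)
  then show ?case by (auto simp: sat_subst)
next
  case (eq_tm x y t)
  show ?case by (simp add: fun_upd_idem)
next
  case (eq_fm y x \<phi>)
  then show ?case by (simp add: sat_subst fun_upd_idem)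
qed (use assms(2) in \<open>force+\<close>)

lemma tm_val_numeral [simp]: "tm_val e (numeral_tm n) = n"
  by (induction n) auto

lemma sat_eq_some_upto [simp]: "sat e (eq_some_upto t n) \<longleftrightarrow> tm_val e t \<le> n"
  by (induction n) auto

lemma R_tilde_sat: "\<phi> \<in> R_tilde \<Longrightarrow> sat e \<phi>"
  by (induction rule: R_tilde.induct) auto

lemma R_tilde_sigma1_consistent: "sigma1_consistent R_tilde"
proof -
  have "sat e \<phi>" if "R_tilde \<turnstile> \<phi>" for e \<phi>
    using that R_tilde_sat by (rule soundness)
  then show ?thesis
    unfolding sigma1_consistent_def by (metis sat.simps(5,6))
qed


section \<open>Completeness for crisp formulas\<close>

lemma vars_numeral [simp]: "vars_tm (numeral_tm n) = {}"
  by (induction n) auto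

text \<open>Addition and multiplication are predicates, so \<open>Zero\<close> and \<open>S\<close>
  are the only function symbols.\<close>

lemma closed_tm_numeral: "vars_tm t = {} \<Longrightarrow> \<exists>n. t = numeral_tm n"
proof (induction t)
  case Zero
  have "Zero = numeral_tm 0" by simp
  then show ?case by blast
next
  case (S t)
  then obtain n where "t = numeral_tm n" by auto
  then have "S t = numeral_tm (Suc n)" by simp
  then show ?case by blast
qed simp

lemma substitutable_closed: "vars_tm u = {} \<Longrightarrow> substitutable u x \<phi>"
  by (induction \<phi>) auto

lemma subst_numeral [simp]: "subst_tm (numeral_tm n) x u = numeral_tm n"
  by (simp add: subst_tm_notin)

lemma subst_eq_some_upto [simp]:
  "subst (eq_some_upto t n) x u = eq_some_upto (subst_tm t x u) n"
  by (induction n) auto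

lemma vars_subst_closed: "vars_tm u = {} \<Longrightarrow> vars_tm (subst_tm t x u) = vars_tm t - {x}"
  by (induction t) auto

lemma free_vars_subst_closed:
  "vars_tm u = {} \<Longrightarrow> free_vars (subst \<phi> x u) = free_vars \<phi> - {x}"
  by (induction \<phi>) (auto simp: vars_subst_closed)

lemma finite_vars_tm: "finite (vars_tm t)"
  by (induction t) auto

text \<open>Bound variables are counted as well: a variable outside this set is neither free nor
  able to capture, so it is safe for renaming.\<close>

primrec all_vars :: "fm \<Rightarrow> nat set" where
  "all_vars (Eq s t) = vars_tm s \<union> vars_tm t"
| "all_vars (Le s t) = vars_tm s \<union> vars_tm t"
| "all_vars (Add r s t) = vars_tm r \<union> vars_tm s \<union> vars_tm t"
| "all_vars (Mul r s t) = vars_tm r \<union> vars_tm s \<union> vars_tm t"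
| "all_vars Bot = {}"
| "all_vars (Imp \<phi> \<psi>) = all_vars \<phi> \<union> all_vars \<psi>"
| "all_vars (And \<phi> \<psi>) = all_vars \<phi> \<union> all_vars \<psi>"
| "all_vars (Or \<phi> \<psi>) = all_vars \<phi> \<union> all_vars \<psi>"
| "all_vars (All y \<phi>) = insert y (all_vars \<phi>)"
| "all_vars (Ex y \<phi>) = insert y (all_vars \<phi>)"

lemma finite_all_vars: "finite (all_vars \<phi>)"
  by (induction \<phi>) (auto simp: finite_vars_tm)

lemma free_vars_subset_all_vars: "free_vars \<phi> \<subseteq> all_vars \<phi>"
  by (induction \<phi>) auto

lemma subst_tm_fresh: "u \<notin> vars_tm s \<Longrightarrow> subst_tm (subst_tm s x (Var u)) u t = subst_tm s x t"
  by (induction s) auto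

lemma subst_fresh: "u \<notin> all_vars \<phi> \<Longrightarrow> subst (subst \<phi> x (Var u)) u t = subst \<phi> x t"
  by (induction \<phi>)
    (auto simp: subst_tm_fresh intro: subst_notin dest: set_mp[OF free_vars_subset_all_vars])

lemma substitutable_fresh_back:
  "u \<notin> all_vars \<phi> \<Longrightarrow> substitutable (Var x) u (subst \<phi> x (Var u))"
  by (induction \<phi>) (auto dest: set_mp[OF free_vars_subset_all_vars])

lemma subst_tm_self [simp]: "subst_tm t x (Var x) = t"
  by (induction t) auto

lemma subst_self [simp]: "subst \<phi> x (Var x) = \<phi>"
  by (induction \<phi>) auto

section \<open>Derived rules\<close>

lemma generalisation: "T \<turnstile> \<phi> \<Longrightarrow> T \<turnstile> All x \<phi>"
  \<comment> \<open>The rule acts on implications only, so \<phi> is first put under the closed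
    theorem \<open>Imp Bot Bot\<close>, which is detached at the end.\<close>
  using all_gen[of T "Imp Bot Bot" \<phi> x] by (auto intro: weakening imp_refl modus_ponens)

lemma specialisation: "T \<turnstile> \<phi> \<Longrightarrow> substitutable t x \<phi> \<Longrightarrow> T \<turnstile> subst \<phi> x t"
  by (meson all_inst generalisation modus_ponens)

lemma specialisation_numeral: "T \<turnstile> \<phi> \<Longrightarrow> T \<turnstile> subst \<phi> x (numeral_tm n)"
  by (simp add: specialisation substitutable_closed)

lemma conjunction: "T \<turnstile> \<phi> \<Longrightarrow> T \<turnstile> \<psi> \<Longrightarrow> T \<turnstile> And \<phi> \<psi>"
  by (meson and_intro imp_refl modus_ponens weakening)

lemma eq_refl_numeral: "T \<turnstile> Eq (numeral_tm n) (numeral_tm n)"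
  using specialisation_numeral[OF eq_refl, of T 0 0 n] by simp

lemma eq_sym_numeral: "T \<turnstile> Imp (Eq (Var x) (numeral_tm n)) (Eq (numeral_tm n) (Var x))"
  using specialisation_numeral[OF eq_sym, of T x "Suc x" "Suc x" n] by simp

text \<open>Detaching \<open>\<phi>(n)\<close> underneath the first implication of \<open>x = n \<rightarrow> (\<phi>(n) \<rightarrow> \<phi>(x))\<close> relies on the
  assertion rule and hence on \<open>\<phi>(n)\<close> being provable outright.\<close>

lemma leibniz_numeral:
  assumes "T \<turnstile> subst \<phi> x (numeral_tm n)"
  shows "T \<turnstile> Imp (Eq (Var x) (numeral_tm n)) \<phi>"
proof -
  \<comment> \<open>\<open>eq_fm\<close> speaks of two variables only. A fresh \<open>u\<close>
    stands in for the numeral and is replaced by it afterwards.\<close>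
  obtain u where u: "u \<notin> insert x (all_vars \<phi>)"
    using finite_all_vars ex_new_if_finite by (metis finite_insert infinite_UNIV_nat)
  define \<psi> where "\<psi> = subst \<phi> x (Var u)"
  have "T \<turnstile> Imp (Eq (Var u) (Var x)) (Imp \<psi> (subst \<psi> u (Var x)))"
    unfolding \<psi>_def by (rule eq_fm, rule substitutable_fresh_back) (use u in auto)
  moreover have "subst \<psi> u (Var x) = \<phi>"
    unfolding \<psi>_def using u by (simp add: subst_fresh)
  ultimately have "T \<turnstile> subst (Imp (Eq (Var u) (Var x)) (Imp \<psi> \<phi>)) u (numeral_tm n)"
    by (metis specialisation_numeral)
  moreover have "subst \<psi> u (numeral_tm n) = subst \<phi> x (numeral_tm n)"
    unfolding \<psi>_def using u by (simp add: subst_fresh)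
  moreover have "subst \<phi> u (numeral_tm n) = \<phi>"
    using u free_vars_subset_all_vars by (intro subst_notin) auto
  ultimately have "T \<turnstile> Imp (Eq (numeral_tm n) (Var x)) (Imp (subst \<phi> x (numeral_tm n)) \<phi>)"
    using u by auto
  then show ?thesis
    by (meson assertion assms eq_sym_numeral transitivity)
qed

text \<open>Unlike \<open>\<Delta>\<^sub>0\<close>-formulas, crisp ones contain implications only in the form of negations: in the
  absence of \<open>\<bottom> \<rightarrow> \<phi>\<close> a true implication between false sentences need not be provable. Allowing terms
  as bounds makes the class closed under substitution of numerals.\<close>

inductive crisp :: "fm \<Rightarrow> bool" where
  crisp_Eq: "crisp (Eq s t)"
| crisp_Le: "crisp (Le s t)"
| crisp_Add: "crisp (Add r s t)"
| crisp_Mul: "crisp (Mul r s t)"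
| crisp_Neg: "crisp \<phi> \<Longrightarrow> crisp (Neg \<phi>)"
| crisp_And: "crisp \<phi> \<Longrightarrow> crisp \<psi> \<Longrightarrow> crisp (And \<phi> \<psi>)"
| crisp_Or: "crisp \<phi> \<Longrightarrow> crisp \<psi> \<Longrightarrow> crisp (Or \<phi> \<psi>)"
| crisp_All: "crisp \<phi> \<Longrightarrow> x \<notin> vars_tm t \<Longrightarrow> crisp (All x (Or (Neg (Le (Var x) t)) \<phi>))"
| crisp_Ex: "crisp \<phi> \<Longrightarrow> x \<notin> vars_tm t \<Longrightarrow> crisp (Ex x (And (Le (Var x) t) \<phi>))"

lemma crisp_subst: "crisp \<phi> \<Longrightarrow> vars_tm u = {} \<Longrightarrow> crisp (subst \<phi> x u)"
proof (induction rule: crisp.induct)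
  case (crisp_All \<phi> y t)
  then show ?case by (auto intro!: crisp.intros simp: vars_subst_closed)
next
  case (crisp_Ex \<phi> y t)
  then show ?case by (auto intro!: crisp.intros simp: vars_subst_closed)
qed (auto intro: crisp.intros)

text \<open>Induction measure for crisp sentences: a numeral instance of the matrix of a quantifier
  is no subformula, but it has the same depth as the matrix.\<close>

primrec depth :: "fm \<Rightarrow> nat" where
  "depth (Eq s t) = 0"
| "depth (Le s t) = 0"
| "depth (Add r s t) = 0"
| "depth (Mul r s t) = 0"
| "depth Bot = 0"
| "depth (Imp \<phi> \<psi>) = Suc (depth \<phi> + depth \<psi>)"
| "depth (And \<phi> \<psi>) = Suc (depth \<phi> + depth \<psi>)"
| "depth (Or \<phi> \<psi>) = Suc (depth \<phi> + depth \<psi>)"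
| "depth (All x \<phi>) = Suc (depth \<phi>)"
| "depth (Ex x \<phi>) = Suc (depth \<phi>)"

lemma depth_subst [simp]: "depth (subst \<phi> x u) = depth \<phi>"
  by (induction \<phi>) auto

section \<open>Sentences decided by every extension of \<open>R_tilde\<close>\<close>

locale R_theory =
  fixes T :: "fm set"
  assumes R_axiom: "\<phi> \<in> R_tilde \<Longrightarrow> T \<turnstile> \<phi>"
begin

text \<open>Truth of a sentence in the standard model does not depend on \<open>e\<close>, so for
  sentences this says that \<open>T\<close> proves the true ones and refutes the false ones.\<close>

definition decided :: "fm \<Rightarrow> bool" where
  "decided \<phi> \<longleftrightarrow> (\<forall>e. (sat e \<phi> \<longrightarrow> T \<turnstile> \<phi>) \<and> (\<not> sat e \<phi> \<longrightarrow> T \<turnstile> Neg \<phi>))"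

lemma Iff_imps:
  assumes "T \<turnstile> Iff \<phi> \<psi>"
  shows "T \<turnstile> Imp \<phi> \<psi>" "T \<turnstile> Imp \<psi> \<phi>"
  using assms and_left and_right modus_ponens by meson+

lemma decided_Iff:
  assumes "T \<turnstile> Iff \<phi> \<psi>" "decided \<psi>" "\<And>e. sat e \<phi> \<longleftrightarrow> sat e \<psi>"
  shows "decided \<phi>"
  using assms Iff_imps[OF assms(1)] unfolding decided_def
  by (meson modus_ponens transitivity)

lemma decided_Eq: "decided (Eq (numeral_tm m) (numeral_tm n))"
  unfolding decided_def using eq_refl_numeral R_axiom[OF R_tilde.neq] by auto

text \<open>If \<phi> is true, it is provable, and the assertion rule yields its double
  negation.\<close>

lemma decided_Neg: "decided \<phi> \<Longrightarrow> decided (Neg \<phi>)"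
  unfolding decided_def using assertion by auto

lemma decided_And: "decided \<phi> \<Longrightarrow> decided \<psi> \<Longrightarrow> decided (And \<phi> \<psi>)"
  unfolding decided_def using conjunction and_left and_right transitivity
  by (metis sat.simps(7))

lemma decided_Or: "decided \<phi> \<Longrightarrow> decided \<psi> \<Longrightarrow> decided (Or \<phi> \<psi>)"
  unfolding decided_def using or_left or_right or_elim modus_ponens
  by (metis sat.simps(8))

lemma decided_eq_some_upto: "decided (eq_some_upto (numeral_tm m) n)"
proof (induction n)
  case 0
  show ?case using decided_Eq[of m 0] by simp
next
  case (Suc n)
  then show ?case using decided_Or decided_Eq[of m "Suc n"] by simp
qed

lemma decided_Le: "decided (Le (numeral_tm m) (numeral_tm n))"
proof (rule decided_Iff)
  show "T \<turnstile> Iff (Le (numeral_tm m) (numeral_tm n)) (eq_some_upto (numeral_tm m) n)"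
    using specialisation_numeral[OF R_axiom[OF R_tilde.le], of 0 n 0 m] by simp
qed (auto simp: decided_eq_some_upto)

lemma decided_Add: "decided (Add (numeral_tm l) (numeral_tm m) (numeral_tm n))"
proof (rule decided_Iff)
  show "T \<turnstile> Iff (Add (numeral_tm l) (numeral_tm m) (numeral_tm n))
    (Eq (numeral_tm (l + m)) (numeral_tm n))"
    using specialisation_numeral[OF R_axiom[OF R_tilde.add], of l m 0 0 n] by simp
qed (auto simp: decided_Eq)

lemma decided_Mul: "decided (Mul (numeral_tm l) (numeral_tm m) (numeral_tm n))"
proof (rule decided_Iff)
  show "T \<turnstile> Iff (Mul (numeral_tm l) (numeral_tm m) (numeral_tm n))
    (Eq (numeral_tm (l * m)) (numeral_tm n))"
    using specialisation_numeral[OF R_axiom[OF R_tilde.mul], of l m 0 0 n] by simp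
qed (auto simp: decided_Eq)

text \<open>The bound \<open>x \<le> n\<close> splits into finitely many equations
  \<open>x = i\<close>, and each of them implies \<phi> because the instance at \<open>i\<close> is
  provable outright.\<close>

lemma bounded_cases:
  assumes "\<And>i. i \<le> n \<Longrightarrow> T \<turnstile> subst \<phi> x (numeral_tm i)"
  shows "T \<turnstile> Imp (Le (Var x) (numeral_tm n)) \<phi>"
proof -
  have "T \<turnstile> Imp (eq_some_upto (Var x) n) \<phi>"
    using assms
  proof (induction n)
    case 0
    then show ?case using leibniz_numeral[of T \<phi> x 0] by simp
  next
    case (Suc n)
    have "T \<turnstile> Imp (Eq (Var x) (numeral_tm (Suc n))) \<phi>"
      by (rule leibniz_numeral) (rule Suc.prems, simp)
    with Suc show ?case by (simp add: or_elim)
  qed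
  then show ?thesis
    using Iff_imps(1)[OF R_axiom[OF R_tilde.le]] transitivity by blast
qed

lemma decided_All:
  assumes "\<And>i. decided (subst \<phi> x (numeral_tm i))"
  shows "decided (All x (Or (Neg (Le (Var x) (numeral_tm n))) \<phi>))" (is "decided ?\<Phi>")
  unfolding decided_def
proof (intro allI conjI impI)
  fix e
  assume sat: "sat e ?\<Phi>"
  have "T \<turnstile> Imp (Le (Var x) (numeral_tm n)) \<phi>"
  proof (rule bounded_cases)
    fix i assume "i \<le> n"
    then have "sat e (subst \<phi> x (numeral_tm i))"
      using sat by (simp add: sat_subst substitutable_closed)
    then show "T \<turnstile> subst \<phi> x (numeral_tm i)"
      using assms unfolding decided_def by blast
  qed
  \<comment> \<open>The case split is the excluded middle for \<open>x \<le> n\<close>, which comes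
    from \<open>R_tilde\<close> and not from the logic.\<close>
  then have "T \<turnstile> Or (Neg (Le (Var x) (numeral_tm n))) \<phi>"
    by (meson R_axiom R_tilde.le_decide modus_ponens or_elim or_left or_right transitivity)
  then show "T \<turnstile> ?\<Phi>" by (rule generalisation)
next
  fix e
  assume "\<not> sat e ?\<Phi>"
  then obtain i where i: "i \<le> n" "\<not> sat (e(x := i)) \<phi>" by auto
  then have "\<not> sat e (subst \<phi> x (numeral_tm i))"
    by (simp add: sat_subst substitutable_closed)
  then have 1: "T \<turnstile> Neg (subst \<phi> x (numeral_tm i))"
    using assms unfolding decided_def by blast
  \<comment> \<open>Both disjuncts of the instance at \<open>i\<close> are refuted; the first one
    because \<open>i \<le> n\<close> is provable and hence also its double negation.\<close>
  have 2: "T \<turnstile> Neg (Neg (Le (numeral_tm i) (numeral_tm n)))"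
    using decided_Neg[OF decided_Le[of i n]] i unfolding decided_def by auto
  have "T \<turnstile> Imp ?\<Phi> (subst (Or (Neg (Le (Var x) (numeral_tm n))) \<phi>) x (numeral_tm i))"
    by (rule all_inst) (simp add: substitutable_closed)
  then show "T \<turnstile> Neg ?\<Phi>"
    using transitivity[OF _ or_elim[OF 2 1]] by simp
qed

lemma decided_Ex:
  assumes "\<And>i. decided (subst \<phi> x (numeral_tm i))"
  shows "decided (Ex x (And (Le (Var x) (numeral_tm n)) \<phi>))" (is "decided ?\<Phi>")
  unfolding decided_def
proof (intro allI conjI impI)
  fix e
  assume "sat e ?\<Phi>"
  then obtain i where i: "i \<le> n" "sat (e(x := i)) \<phi>" by auto
  then have "sat e (subst \<phi> x (numeral_tm i))"
    by (simp add: sat_subst substitutable_closed)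
  then have 1: "T \<turnstile> subst \<phi> x (numeral_tm i)"
    using assms unfolding decided_def by blast
  have 2: "T \<turnstile> Le (numeral_tm i) (numeral_tm n)"
    using decided_Le[of i n] i unfolding decided_def by auto
  have "T \<turnstile> Imp (subst (And (Le (Var x) (numeral_tm n)) \<phi>) x (numeral_tm i)) ?\<Phi>"
    by (rule ex_inst) (simp add: substitutable_closed)
  then show "T \<turnstile> ?\<Phi>"
    using modus_ponens[OF conjunction[OF 2 1]] by simp
next
  fix e
  assume nsat: "\<not> sat e ?\<Phi>"
  have "T \<turnstile> Imp (Le (Var x) (numeral_tm n)) (Neg \<phi>)"
  proof (rule bounded_cases)
    fix i assume "i \<le> n"
    then have "\<not> sat e (subst \<phi> x (numeral_tm i))"
      using nsat by (simp add: sat_subst substitutable_closed)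
    then show "T \<turnstile> subst (Neg \<phi>) x (numeral_tm i)"
      using assms unfolding decided_def by simp
  qed
  \<comment> \<open>The De Morgan rule wants a disjunction of negations as its premise, so the
    excluded middle for \<open>x \<le> n\<close> is used once more.\<close>
  then have "T \<turnstile> Or (Neg (Le (Var x) (numeral_tm n))) (Neg \<phi>)"
    by (meson R_axiom R_tilde.le_decide modus_ponens or_elim or_left or_right transitivity)
  then have "T \<turnstile> Neg (And (Le (Var x) (numeral_tm n)) \<phi>)" by (rule de_morgan)
  then show "T \<turnstile> Neg ?\<Phi>" by (rule ex_gen) simp
qed

lemma crisp_decided: "crisp \<phi> \<Longrightarrow> free_vars \<phi> = {} \<Longrightarrow> decided \<phi>"
proof (induction "depth \<phi>" arbitrary: \<phi> rule: less_induct)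
  case less
  have IH: "decided (subst \<psi> x (numeral_tm i))"
    if "crisp \<psi>" "depth \<psi> < depth \<phi>" "free_vars \<psi> \<subseteq> {x}" for \<psi> x i
    using that by (intro less.hyps) (auto simp: crisp_subst free_vars_subst_closed)
  from less.prems(1) show ?case
  proof cases
    case (crisp_Eq s t)
    then show ?thesis using less.prems(2) closed_tm_numeral decided_Eq by auto metis
  next
    case (crisp_Le s t)
    then show ?thesis using less.prems(2) closed_tm_numeral decided_Le by auto metis
  next
    case (crisp_Add r s t)
    then show ?thesis using less.prems(2) closed_tm_numeral decided_Add by auto metis
  next
    case (crisp_Mul r s t)
    then show ?thesis using less.prems(2) closed_tm_numeral decided_Mul by auto metis
  next
    case (crisp_Neg \<psi>)
    then show ?thesis using less by (simp add: decided_Neg)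
  next
    case (crisp_And \<psi> \<chi>)
    then show ?thesis using less by (simp add: decided_And)
  next
    case (crisp_Or \<psi> \<chi>)
    then show ?thesis using less by (simp add: decided_Or)
  next
    case (crisp_All \<psi> x t)
    \<comment> \<open>As \<open>x\<close> does not occur in \<open>t\<close>, closedness of the
      whole formula makes \<open>t\<close> closed, hence a numeral.\<close>
    then obtain n where "t = numeral_tm n" using less.prems(2) closed_tm_numeral[of t] by auto
    moreover have "decided (subst \<psi> x (numeral_tm i))" for i
      using crisp_All less.prems(2) by (intro IH) auto
    ultimately show ?thesis using crisp_All decided_All by blast
  next
    case (crisp_Ex \<psi> x t)
    then obtain n where "t = numeral_tm n" using less.prems(2) closed_tm_numeral[of t] by auto
    moreover have "decided (subst \<psi> x (numeral_tm i))" for i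
      using crisp_Ex less.prems(2) by (intro IH) auto
    ultimately show ?thesis using crisp_Ex decided_Ex by blast
  qed
qed

lemma crisp_true: "crisp \<phi> \<Longrightarrow> free_vars \<phi> = {} \<Longrightarrow> sat e \<phi> \<Longrightarrow> T \<turnstile> \<phi>"
  using crisp_decided unfolding decided_def by blast

end


section \<open>\<open>\<Sigma>\<^sub>1\<close>-relations\<close>

text \<open>Quantifying over all lists \<open>vs\<close> of variables, possibly with repetitions, makes renaming and
  identification of variables trivial, so that no syntactic substitution is needed. The last
  variable \<open>w\<close> is a common bound for all existential witnesses; monotonicity in \<open>w\<close> is what makes
  the class closed under conjunction and bounded universal quantification.\<close>

definition sigma_formula :: "nat list \<Rightarrow> nat \<Rightarrow> (nat list \<Rightarrow> bool) \<Rightarrow> fm \<Rightarrow> bool" where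
  "sigma_formula vs w R \<phi> \<longleftrightarrow> crisp \<phi> \<and> delta0 \<phi> \<and> free_vars \<phi> \<subseteq> insert w (set vs) \<and>
     (\<forall>e k l. sat (e(w := k)) \<phi> \<longrightarrow> k \<le> l \<longrightarrow> sat (e(w := l)) \<phi>) \<and>
     (\<forall>e. R (map e vs) \<longleftrightarrow> (\<exists>k. sat (e(w := k)) \<phi>))"

definition sigma_rel :: "nat \<Rightarrow> (nat list \<Rightarrow> bool) \<Rightarrow> bool" where
  "sigma_rel n R \<longleftrightarrow>
     (\<forall>vs w. length vs = n \<longrightarrow> w \<notin> set vs \<longrightarrow> (\<exists>\<phi>. sigma_formula vs w R \<phi>))"

lemma sigma_formulaD:
  assumes "sigma_formula vs w R \<phi>"
  shows "crisp \<phi>" "delta0 \<phi>" "free_vars \<phi> \<subseteq> insert w (set vs)"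
    "\<And>e k l. sat (e(w := k)) \<phi> \<Longrightarrow> k \<le> l \<Longrightarrow> sat (e(w := l)) \<phi>"
    "\<And>e. R (map e vs) \<longleftrightarrow> (\<exists>k. sat (e(w := k)) \<phi>)"
  using assms unfolding sigma_formula_def by blast+

lemma sigma_formulaI:
  assumes "crisp \<phi>" "delta0 \<phi>" "free_vars \<phi> \<subseteq> insert w (set vs)"
    "\<And>e k l. sat (e(w := k)) \<phi> \<Longrightarrow> k \<le> l \<Longrightarrow> sat (e(w := l)) \<phi>"
    "\<And>e. R (map e vs) \<longleftrightarrow> (\<exists>k. sat (e(w := k)) \<phi>)"
  shows "sigma_formula vs w R \<phi>"
  using assms unfolding sigma_formula_def by blast

lemma sigma_relD:
  assumes "sigma_rel n R" "length vs = n" "w \<notin> set vs"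
  shows "\<exists>\<phi>. sigma_formula vs w R \<phi>"
  using assms unfolding sigma_rel_def by blast

lemma sigma_rel_cong:
  assumes "\<And>xs. length xs = n \<Longrightarrow> R xs \<longleftrightarrow> R' xs"
  shows "sigma_rel n R \<longleftrightarrow> sigma_rel n R'"
proof -
  have "sigma_formula vs w R \<phi> \<longleftrightarrow> sigma_formula vs w R' \<phi>" if "length vs = n" for vs w \<phi>
    using assms that unfolding sigma_formula_def by simp
  then show ?thesis unfolding sigma_rel_def by blast
qed

text \<open>A defining formula that does not mention \<open>w\<close> is trivially monotone in
  it.\<close>

lemma sigma_rel_literal:
  assumes "\<And>vs. length vs = n \<Longrightarrow> \<exists>\<phi>. crisp \<phi> \<and> delta0 \<phi> \<and> free_vars \<phi> \<subseteq> set vs \<and>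
    (\<forall>e. sat e \<phi> \<longleftrightarrow> R (map e vs))"
  shows "sigma_rel n R"
  unfolding sigma_rel_def
proof (intro allI impI)
  fix vs :: "nat list" and w
  assume vs: "length vs = n" and w: "w \<notin> set vs"
  from assms[OF vs] obtain \<phi> where \<phi>: "crisp \<phi>" "delta0 \<phi>" "free_vars \<phi> \<subseteq> set vs"
    "\<And>e. sat e \<phi> \<longleftrightarrow> R (map e vs)" by blast
  then have "sat (e(w := k)) \<phi> \<longleftrightarrow> sat e \<phi>" for e k
    using w by (intro sat_upd) auto
  with \<phi> have "sigma_formula vs w R \<phi>"
    by (intro sigma_formulaI) auto
  then show "\<exists>\<phi>. sigma_formula vs w R \<phi>" ..
qed

lemma sigma_rel_and:
  assumes "sigma_rel n R" "sigma_rel n R'"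
  shows "sigma_rel n (\<lambda>xs. R xs \<and> R' xs)"
  unfolding sigma_rel_def
proof (intro allI impI)
  fix vs :: "nat list" and w
  assume vs: "length vs = n" "w \<notin> set vs"
  obtain \<phi> where "sigma_formula vs w R \<phi>" using sigma_relD[OF assms(1) vs] by blast
  note \<phi> = sigma_formulaD[OF this]
  obtain \<psi> where "sigma_formula vs w R' \<psi>" using sigma_relD[OF assms(2) vs] by blast
  note \<psi> = sigma_formulaD[OF this]
  have "(R (map e vs) \<and> R' (map e vs)) \<longleftrightarrow> (\<exists>k. sat (e(w := k)) (And \<phi> \<psi>))" for e
  proof
    assume "R (map e vs) \<and> R' (map e vs)"
    then obtain k l where "sat (e(w := k)) \<phi>" "sat (e(w := l)) \<psi>"
      using \<phi>(5) \<psi>(5) by blast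
    then have "sat (e(w := max k l)) (And \<phi> \<psi>)"
      using \<phi>(4) \<psi>(4) by (metis max.cobounded1 max.cobounded2 sat.simps(7))
    then show "\<exists>k. sat (e(w := k)) (And \<phi> \<psi>)" by blast
  qed (use \<phi>(5) \<psi>(5) in auto)
  then have "sigma_formula vs w (\<lambda>xs. R xs \<and> R' xs) (And \<phi> \<psi>)"
    using \<phi>(1-3) \<psi>(1-3)
    by (intro sigma_formulaI crisp_And delta0.intros) (auto dest: \<phi>(4) \<psi>(4))
  then show "\<exists>\<phi>. sigma_formula vs w (\<lambda>xs. R xs \<and> R' xs) \<phi>" ..
qed

lemma sigma_rel_or:
  assumes "sigma_rel n R" "sigma_rel n R'"
  shows "sigma_rel n (\<lambda>xs. R xs \<or> R' xs)"
  unfolding sigma_rel_def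
proof (intro allI impI)
  fix vs :: "nat list" and w
  assume vs: "length vs = n" "w \<notin> set vs"
  obtain \<phi> where "sigma_formula vs w R \<phi>" using sigma_relD[OF assms(1) vs] by blast
  note \<phi> = sigma_formulaD[OF this]
  obtain \<psi> where "sigma_formula vs w R' \<psi>" using sigma_relD[OF assms(2) vs] by blast
  note \<psi> = sigma_formulaD[OF this]
  have "sigma_formula vs w (\<lambda>xs. R xs \<or> R' xs) (Or \<phi> \<psi>)"
    using \<phi>(1-3) \<psi>(1-3)
    by (intro sigma_formulaI crisp_Or delta0.intros) (auto simp: \<phi>(5) \<psi>(5) dest: \<phi>(4) \<psi>(4))
  then show "\<exists>\<phi>. sigma_formula vs w (\<lambda>xs. R xs \<or> R' xs) \<phi>" ..
qed

text \<open>The new quantifier is bounded by \<open>w\<close> itself, so one bound serves the new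
  variable and the witnesses already there.\<close>

lemma sigma_rel_ex:
  assumes "sigma_rel (Suc n) R"
  shows "sigma_rel n (\<lambda>xs. \<exists>y. R (y # xs))"
  unfolding sigma_rel_def
proof (intro allI impI)
  fix vs :: "nat list" and w
  assume vs: "length vs = n" "w \<notin> set vs"
  obtain z where z: "z \<notin> insert w (set vs)"
    using ex_new_if_finite[OF infinite_UNIV_nat] by (metis List.finite_set finite_insert)
  have "length (z # vs) = Suc n" "w \<notin> set (z # vs)" using vs z by auto
  then obtain \<phi> where "sigma_formula (z # vs) w R \<phi>"
    using sigma_relD[OF assms] by blast
  note \<phi> = sigma_formulaD[OF this]
  have twist: "(e(w := k))(z := i) = (e(z := i))(w := k)" for e :: "nat \<Rightarrow> nat" and k i
    using z by (intro fun_upd_twist) auto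
  have sat: "sat (e(w := k)) (BEx z w \<phi>) \<longleftrightarrow> (\<exists>i\<le>k. sat ((e(z := i))(w := k)) \<phi>)" for e k
    using z unfolding twist[symmetric] by auto
  have R: "R (y # map e vs) \<longleftrightarrow> (\<exists>k. sat ((e(z := y))(w := k)) \<phi>)" for e y
  proof -
    have "map (e(z := y)) (z # vs) = y # map e vs" using z by auto
    then show ?thesis using \<phi>(5)[of "e(z := y)"] by metis
  qed
  have mono: "sat (e(w := l)) (BEx z w \<phi>)" if "sat (e(w := k)) (BEx z w \<phi>)" "k \<le> l" for e k l
    using that \<phi>(4) unfolding sat by (meson le_trans)
  have "(\<exists>y. R (y # map e vs)) \<longleftrightarrow> (\<exists>k. sat (e(w := k)) (BEx z w \<phi>))" for e
    unfolding sat R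
  proof
    assume "\<exists>y k. sat ((e(z := y))(w := k)) \<phi>"
    then obtain y k where "sat ((e(z := y))(w := k)) \<phi>" by blast
    \<comment> \<open>By monotonicity the old bound may be raised until it also covers
      \<open>y\<close>.\<close>
    then have "sat ((e(z := y))(w := max k y)) \<phi>" using \<phi>(4) max.cobounded1 by blast
    then show "\<exists>k. \<exists>i\<le>k. sat ((e(z := i))(w := k)) \<phi>" using max.cobounded2 by blast
  qed blast
  moreover have "crisp (BEx z w \<phi>)" "delta0 (BEx z w \<phi>)"
    using z \<phi> by (auto intro!: crisp_Ex delta0.intros)
  moreover have "free_vars (BEx z w \<phi>) \<subseteq> insert w (set vs)" using \<phi>(3) by auto
  ultimately have "sigma_formula vs w (\<lambda>xs. \<exists>y. R (y # xs)) (BEx z w \<phi>)"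
    using mono by (intro sigma_formulaI)
  then show "\<exists>\<phi>. sigma_formula vs w (\<lambda>xs. \<exists>y. R (y # xs)) \<phi>" ..
qed

lemma sigma_rel_ball:
  assumes "sigma_rel (Suc n) R" "j < n"
  shows "sigma_rel n (\<lambda>xs. \<forall>y\<le>xs ! j. R (y # xs))"
  unfolding sigma_rel_def
proof (intro allI impI)
  fix vs :: "nat list" and w
  assume vs: "length vs = n" "w \<notin> set vs"
  define b where "b = vs ! j"
  have b: "b \<in> set vs" "map e vs ! j = e b" for e :: "nat \<Rightarrow> nat"
    using vs assms(2) unfolding b_def by auto
  obtain z where z: "z \<notin> insert w (set vs)"
    using ex_new_if_finite[OF infinite_UNIV_nat] by (metis List.finite_set finite_insert)
  have "length (z # vs) = Suc n" "w \<notin> set (z # vs)" using vs z by auto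
  then obtain \<phi> where "sigma_formula (z # vs) w R \<phi>"
    using sigma_relD[OF assms(1)] by blast
  note \<phi> = sigma_formulaD[OF this]
  have zb: "z \<noteq> b" "w \<noteq> b" using z b vs by auto
  have twist: "(e(w := k))(z := i) = (e(z := i))(w := k)" for e :: "nat \<Rightarrow> nat" and k i
    using z by (intro fun_upd_twist) auto
  have sat: "sat (e(w := k)) (BAll z b \<phi>) \<longleftrightarrow> (\<forall>i\<le>e b. sat ((e(z := i))(w := k)) \<phi>)" for e k
    using zb unfolding twist[symmetric] by auto
  have R: "R (y # map e vs) \<longleftrightarrow> (\<exists>k. sat ((e(z := y))(w := k)) \<phi>)" for e y
  proof -
    have "map (e(z := y)) (z # vs) = y # map e vs" using z by auto
    then show ?thesis using \<phi>(5)[of "e(z := y)"] by metis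
  qed
  have mono: "sat (e(w := l)) (BAll z b \<phi>)" if "sat (e(w := k)) (BAll z b \<phi>)" "k \<le> l" for e k l
    using that \<phi>(4) unfolding sat by blast
  have "(\<forall>y\<le>map e vs ! j. R (y # map e vs)) \<longleftrightarrow> (\<exists>k. sat (e(w := k)) (BAll z b \<phi>))" for e
    unfolding sat R b(2)
  proof
    assume "\<forall>y\<le>e b. \<exists>k. sat ((e(z := y))(w := k)) \<phi>"
    then obtain k where k: "\<And>y. y \<le> e b \<Longrightarrow> sat ((e(z := y))(w := k y)) \<phi>" by metis
    \<comment> \<open>Only finitely many \<open>y\<close> occur, so the maximum of their bounds
      serves all of them at once.\<close>
    have "sat ((e(z := y))(w := Max (k ` {..e b}))) \<phi>" if "y \<le> e b" for y
      using \<phi>(4)[OF k[OF that]] that by simp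
    then show "\<exists>k. \<forall>i\<le>e b. sat ((e(z := i))(w := k)) \<phi>" by blast
  qed blast
  moreover have "crisp (BAll z b \<phi>)" "delta0 (BAll z b \<phi>)"
    using zb \<phi> by (auto intro!: crisp_All delta0.intros)
  moreover have "free_vars (BAll z b \<phi>) \<subseteq> insert w (set vs)" using \<phi>(3) b by auto
  ultimately have "sigma_formula vs w (\<lambda>xs. \<forall>y\<le>xs ! j. R (y # xs)) (BAll z b \<phi>)"
    using mono by (intro sigma_formulaI)
  then show "\<exists>\<phi>. sigma_formula vs w (\<lambda>xs. \<forall>y\<le>xs ! j. R (y # xs)) \<phi>" ..
qed

text \<open>The formula obtained for the list of variables selected by \<open>js\<close> serves;
  repetitions in \<open>js\<close> merely identify variables.\<close>

lemma sigma_rel_rename: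
  assumes "sigma_rel (length js) R" "\<And>j. j \<in> set js \<Longrightarrow> j < n"
  shows "sigma_rel n (\<lambda>xs. R (map ((!) xs) js))"
  unfolding sigma_rel_def
proof (intro allI impI)
  fix vs :: "nat list" and w
  assume vs: "length vs = n" "w \<notin> set vs"
  have sub: "set (map ((!) vs) js) \<subseteq> set vs" using vs assms(2) by auto
  have "length (map ((!) vs) js) = length js" "w \<notin> set (map ((!) vs) js)" using vs sub by auto
  then obtain \<phi> where "sigma_formula (map ((!) vs) js) w R \<phi>"
    using sigma_relD[OF assms(1)] by blast
  note \<phi> = sigma_formulaD[OF this]
  have "map e (map ((!) vs) js) = map ((!) (map e vs)) js" for e
    using vs assms(2) by auto
  then have "R (map ((!) (map e vs)) js) \<longleftrightarrow> (\<exists>k. sat (e(w := k)) \<phi>)" for e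
    using \<phi>(5)[of e] by metis
  moreover have "free_vars \<phi> \<subseteq> insert w (set vs)" using \<phi>(3) sub by blast
  ultimately have "sigma_formula vs w (\<lambda>xs. R (map ((!) xs) js)) \<phi>"
    using \<phi>(1,2,4) by (intro sigma_formulaI)
  then show "\<exists>\<phi>. sigma_formula vs w (\<lambda>xs. R (map ((!) xs) js)) \<phi>" ..
qed

lemma sigma_rel_ex_list:
  "sigma_rel (m + n) R \<Longrightarrow> sigma_rel n (\<lambda>xs. \<exists>ys. length ys = m \<and> R (ys @ xs))"
proof (induction m arbitrary: R)
  case (Suc m)
  then have "sigma_rel (m + n) (\<lambda>xs. \<exists>y. R (y # xs))"
    by (intro sigma_rel_ex) simp
  from Suc.IH[OF this]
  have "sigma_rel n (\<lambda>xs. \<exists>ys. length ys = m \<and> (\<exists>y. R (y # ys @ xs)))" .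
  moreover have "(\<exists>ys. length ys = m \<and> (\<exists>y. R (y # ys @ xs))) \<longleftrightarrow>
      (\<exists>ys. length ys = Suc m \<and> R (ys @ xs))" for xs
    by (metis append_Cons length_Suc_conv)
  ultimately show ?case by simp
qed simp

lemma sigma_rel_True: "sigma_rel n (\<lambda>xs. True)"
  by (rule sigma_rel_literal, rule exI[of _ "Eq Zero Zero"]) (auto intro: crisp.intros delta0.intros)

lemma sigma_rel_all_less:
  fixes m :: nat
  shows "(\<And>i. i < m \<Longrightarrow> sigma_rel n (R i)) \<Longrightarrow> sigma_rel n (\<lambda>xs. \<forall>i<m. R i xs)"
proof (induction m)
  case (Suc m)
  then have "sigma_rel n (\<lambda>xs. R m xs \<and> (\<forall>i<m. R i xs))"
    by (intro sigma_rel_and) auto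
  then show ?case by (simp add: All_less_Suc)
qed (simp add: sigma_rel_True)

section \<open>Functions with a \<open>\<Sigma>\<^sub>1\<close> graph\<close>

definition sigma_fun :: "nat \<Rightarrow> (nat list \<Rightarrow> nat) \<Rightarrow> bool" where
  "sigma_fun n f \<longleftrightarrow> sigma_rel (Suc n) (\<lambda>ys. hd ys = f (tl ys))"

lemma sigma_fun_cong:
  assumes "\<And>xs. length xs = n \<Longrightarrow> f xs = f' xs"
  shows "sigma_fun n f \<longleftrightarrow> sigma_fun n f'"
  unfolding sigma_fun_def by (rule sigma_rel_cong) (simp add: assms)

text \<open>The intermediate values are guessed as an existentially quantified list
  \<open>ys\<close> in front of \<open>xs\<close>, each entry is checked against its function, and
  \<open>R\<close> is applied to \<open>ys\<close>.\<close>

lemma sigma_rel_comp: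
  assumes R: "sigma_rel (length gs) R" and gs: "\<And>g. g \<in> set gs \<Longrightarrow> sigma_fun n g"
  shows "sigma_rel n (\<lambda>xs. R (map (\<lambda>g. g xs) gs))"
proof -
  let ?m = "length gs"
  have "sigma_rel (?m + n) (\<lambda>zs. zs ! i = (gs ! i) (drop ?m zs))" if "i < ?m" for i
  proof -
    have "sigma_rel (length (i # [?m..<?m + n])) (\<lambda>ys. hd ys = (gs ! i) (tl ys))"
      using gs[of "gs ! i"] that unfolding sigma_fun_def by simp
    then have "sigma_rel (?m + n) (\<lambda>zs. hd (map ((!) zs) (i # [?m..<?m + n])) =
        (gs ! i) (tl (map ((!) zs) (i # [?m..<?m + n]))))"
      by (rule sigma_rel_rename) (use that in auto)
    moreover have "map ((!) zs) [?m..<?m + n] = drop ?m zs" if "length zs = ?m + n" for zs :: "nat list"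
      using that by (intro nth_equalityI) auto
    ultimately show ?thesis
      by (subst sigma_rel_cong) auto
  qed
  moreover have "sigma_rel (?m + n) (\<lambda>zs. R (take ?m zs))"
  proof -
    have "sigma_rel (?m + n) (\<lambda>zs. R (map ((!) zs) [0..<?m]))"
      by (rule sigma_rel_rename) (use R in auto)
    moreover have "map ((!) zs) [0..<?m] = take ?m zs" if "length zs = ?m + n" for zs :: "nat list"
      using that by (intro nth_equalityI) auto
    ultimately show ?thesis
      by (subst sigma_rel_cong) auto
  qed
  ultimately have "sigma_rel (?m + n) (\<lambda>zs. (\<forall>i<?m. zs ! i = (gs ! i) (drop ?m zs)) \<and> R (take ?m zs))"
    by (intro sigma_rel_and sigma_rel_all_less)
  from sigma_rel_ex_list[OF this]
  have "sigma_rel n (\<lambda>xs. \<exists>ys. length ys = ?m \<and>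
      (\<forall>i<?m. (ys @ xs) ! i = (gs ! i) (drop ?m (ys @ xs))) \<and> R (take ?m (ys @ xs)))" .
  moreover have "(\<exists>ys. length ys = ?m \<and>
      (\<forall>i<?m. (ys @ xs) ! i = (gs ! i) (drop ?m (ys @ xs))) \<and> R (take ?m (ys @ xs))) \<longleftrightarrow>
      R (map (\<lambda>g. g xs) gs)" for xs
  proof
    assume "\<exists>ys. length ys = ?m \<and>
      (\<forall>i<?m. (ys @ xs) ! i = (gs ! i) (drop ?m (ys @ xs))) \<and> R (take ?m (ys @ xs))"
    then obtain ys where ys: "length ys = ?m" "\<And>i. i < ?m \<Longrightarrow> ys ! i = (gs ! i) xs" "R ys"
      by (auto simp: nth_append)
    have "ys = map (\<lambda>g. g xs) gs"
      by (rule nth_equalityI) (use ys in auto)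
    with ys show "R (map (\<lambda>g. g xs) gs)" by simp
  next
    assume "R (map (\<lambda>g. g xs) gs)"
    then show "\<exists>ys. length ys = ?m \<and>
      (\<forall>i<?m. (ys @ xs) ! i = (gs ! i) (drop ?m (ys @ xs))) \<and> R (take ?m (ys @ xs))"
      by (intro exI[of _ "map (\<lambda>g. g xs) gs"]) (auto simp: nth_append)
  qed
  ultimately show ?thesis by simp
qed

lemma sigma_fun_nth:
  assumes "i < n"
  shows "sigma_fun n (\<lambda>xs. xs ! i)"
  unfolding sigma_fun_def
proof (rule sigma_rel_literal)
  fix vs :: "nat list"
  assume vs: "length vs = Suc n"
  then have "hd (map e vs) = e (vs ! 0)" "tl (map e vs) ! i = e (vs ! Suc i)" for e :: "nat \<Rightarrow> nat"
    using assms by (cases vs; simp)+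
  then show "\<exists>\<phi>. crisp \<phi> \<and> delta0 \<phi> \<and> free_vars \<phi> \<subseteq> set vs \<and>
    (\<forall>e. sat e \<phi> \<longleftrightarrow> hd (map e vs) = tl (map e vs) ! i)"
    using vs assms
    by (intro exI[of _ "Eq (Var (vs ! 0)) (Var (vs ! Suc i))"]) (auto intro: crisp.intros delta0.intros)
qed

lemma sigma_fun_tl:
  assumes "sigma_fun n f"
  shows "sigma_fun (Suc n) (\<lambda>xs. f (tl xs))"
proof -
  have "sigma_rel (Suc (Suc n)) (\<lambda>zs. (\<lambda>ys. hd ys = f (tl ys)) (map ((!) zs) (0 # [2..<n + 2])))"
    by (rule sigma_rel_rename) (use assms in \<open>auto simp: sigma_fun_def simp del: upt_Suc\<close>)
  moreover have "map ((!) zs) [2..<n + 2] = tl (tl zs)" "zs ! 0 = hd zs"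
    if "length zs = Suc (Suc n)" for zs :: "nat list"
  proof -
    show "map ((!) zs) [2..<n + 2] = tl (tl zs)"
      using that by (intro nth_equalityI) (auto simp: nth_tl simp del: upt_Suc)
    show "zs ! 0 = hd zs" using that by (cases zs) auto
  qed
  ultimately show ?thesis
    unfolding sigma_fun_def by (subst sigma_rel_cong) (auto simp del: upt_Suc)
qed

lemma sigma_fun_comp:
  assumes "sigma_fun (length gs) f" "\<And>g. g \<in> set gs \<Longrightarrow> sigma_fun n g"
  shows "sigma_fun n (\<lambda>xs. f (map (\<lambda>g. g xs) gs))"
proof -
  \<comment> \<open>The head of the list is the value and is passed on unchanged; the given
    functions see only the tail.\<close>
  let ?gs = "(\<lambda>ys. ys ! 0) # map (\<lambda>g ys. g (tl ys)) gs"
  have "sigma_rel (Suc n) (\<lambda>ys. (\<lambda>ys. hd ys = f (tl ys)) (map (\<lambda>g. g ys) ?gs))"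
  proof (rule sigma_rel_comp)
    show "sigma_rel (length ?gs) (\<lambda>ys. hd ys = f (tl ys))"
      using assms(1) by (simp add: sigma_fun_def)
  qed (use assms(2) in \<open>auto intro: sigma_fun_nth sigma_fun_tl\<close>)
  moreover have "ys ! 0 = hd ys" if "length ys = Suc n" for ys :: "nat list"
    using that by (cases ys) auto
  ultimately show ?thesis
    unfolding sigma_fun_def by (subst sigma_rel_cong) (auto simp: comp_def)
qed

text \<open>Form suited to recursion and minimisation: the first \<open>d\<close> entries are
  auxiliary, the remaining \<open>m\<close> are parameters handed to \<open>f\<close>
  unchanged.\<close>

lemma sigma_fun_comp_drop:
  assumes "sigma_fun (length gs + m) f" "\<And>g. g \<in> set gs \<Longrightarrow> sigma_fun (d + m) g"
  shows "sigma_fun (d + m) (\<lambda>xs. f (map (\<lambda>g. g xs) gs @ drop d xs))"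
proof -
  let ?gs = "gs @ map (\<lambda>i xs. xs ! i) [d..<d + m]"
  have "sigma_fun (d + m) (\<lambda>xs. f (map (\<lambda>g. g xs) ?gs))"
    by (rule sigma_fun_comp) (use assms in \<open>auto intro: sigma_fun_nth\<close>)
  moreover have "map (\<lambda>i. xs ! i) [d..<d + m] = drop d xs" if "length xs = d + m" for xs :: "nat list"
    using that by (intro nth_equalityI) auto
  ultimately show ?thesis
    by (subst sigma_fun_cong) (auto simp: comp_def)
qed

lemma sigma_rel_binary:
  assumes "\<And>u v. \<exists>\<phi>. crisp \<phi> \<and> delta0 \<phi> \<and> free_vars \<phi> \<subseteq> {u, v} \<and> (\<forall>e. sat e \<phi> \<longleftrightarrow> P (e u) (e v))"
    and "sigma_fun n f" "sigma_fun n g"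
  shows "sigma_rel n (\<lambda>xs. P (f xs) (g xs))"
proof -
  have "sigma_rel (length [f, g]) (\<lambda>xs. P (xs ! 0) (xs ! 1))"
  proof (rule sigma_rel_literal)
    fix vs :: "nat list"
    assume "length vs = length [f, g]"
    then obtain u v where "vs = [u, v]" by (auto simp: length_Suc_conv)
    then show "\<exists>\<phi>. crisp \<phi> \<and> delta0 \<phi> \<and> free_vars \<phi> \<subseteq> set vs \<and>
        (\<forall>e. sat e \<phi> \<longleftrightarrow> P (map e vs ! 0) (map e vs ! 1))"
      using assms(1)[of u v] by simp
  qed
  then have "sigma_rel n (\<lambda>xs. P (map (\<lambda>g. g xs) [f, g] ! 0) (map (\<lambda>g. g xs) [f, g] ! 1))"
    by (rule sigma_rel_comp) (use assms in auto)
  then show ?thesis by simp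
qed

lemma sigma_rel_eq: "sigma_fun n f \<Longrightarrow> sigma_fun n g \<Longrightarrow> sigma_rel n (\<lambda>xs. f xs = g xs)"
proof (rule sigma_rel_binary[where P = "(=)"])
  fix u v
  show "\<exists>\<phi>. crisp \<phi> \<and> delta0 \<phi> \<and> free_vars \<phi> \<subseteq> {u, v} \<and> (\<forall>e. sat e \<phi> \<longleftrightarrow> e u = e v)"
    by (rule exI[of _ "Eq (Var u) (Var v)"]) (auto intro: crisp.intros delta0.intros)
qed

lemma sigma_rel_less: "sigma_fun n f \<Longrightarrow> sigma_fun n g \<Longrightarrow> sigma_rel n (\<lambda>xs. f xs < g xs)"
proof (rule sigma_rel_binary[where P = "(<)"])
  fix u v
  show "\<exists>\<phi>. crisp \<phi> \<and> delta0 \<phi> \<and> free_vars \<phi> \<subseteq> {u, v} \<and> (\<forall>e. sat e \<phi> \<longleftrightarrow> e u < e v)"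
    by (rule exI[of _ "Le (S (Var u)) (Var v)"]) (auto intro: crisp.intros delta0.intros)
qed

lemma sigma_fun_literal:
  assumes "\<And>y xs. length xs = n \<Longrightarrow> y = f xs \<longleftrightarrow> R (y # xs)" "sigma_rel (Suc n) R"
  shows "sigma_fun n f"
proof -
  have "sigma_rel (Suc n) (\<lambda>ys. hd ys = f (tl ys)) \<longleftrightarrow> sigma_rel (Suc n) R"
    by (rule sigma_rel_cong) (auto simp: length_Suc_conv assms(1))
  then show ?thesis unfolding sigma_fun_def using assms(2) by simp
qed

lemma sigma_fun_numeral: "sigma_fun n (\<lambda>xs. m)"
  unfolding sigma_fun_def
proof (rule sigma_rel_literal)
  fix vs :: "nat list"
  assume "length vs = Suc n"
  then have "hd (map e vs) = e (vs ! 0)" "vs ! 0 \<in> set vs" for e :: "nat \<Rightarrow> nat" by (cases vs; simp)+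
  then show "\<exists>\<phi>. crisp \<phi> \<and> delta0 \<phi> \<and> free_vars \<phi> \<subseteq> set vs \<and> (\<forall>e. sat e \<phi> \<longleftrightarrow> hd (map e vs) = m)"
    by (intro exI[of _ "Eq (Var (vs ! 0)) (numeral_tm m)"]) (auto intro: crisp.intros delta0.intros)
qed

lemma sigma_fun_Suc:
  assumes "sigma_fun n f"
  shows "sigma_fun n (\<lambda>xs. Suc (f xs))"
proof -
  have "sigma_rel (Suc n) (\<lambda>ys. ys ! 0 = Suc (f (tl ys)))"
  proof (rule sigma_rel_binary[where P = "\<lambda>a b. a = Suc b"])
    fix u v
    show "\<exists>\<phi>. crisp \<phi> \<and> delta0 \<phi> \<and> free_vars \<phi> \<subseteq> {u, v} \<and> (\<forall>e. sat e \<phi> \<longleftrightarrow> e u = Suc (e v))"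
      by (rule exI[of _ "Eq (Var u) (S (Var v))"]) (auto intro: crisp.intros delta0.intros)
  qed (auto intro: sigma_fun_nth sigma_fun_tl assms)
  then show ?thesis
    by (rule sigma_fun_literal[rotated]) auto
qed

lemma sigma_fun_binary:
  assumes "\<And>u v w. \<exists>\<phi>. crisp \<phi> \<and> delta0 \<phi> \<and> free_vars \<phi> \<subseteq> {u, v, w} \<and>
      (\<forall>e. sat e \<phi> \<longleftrightarrow> F (e u) (e v) = e w)"
    and "sigma_fun n f" "sigma_fun n g"
  shows "sigma_fun n (\<lambda>xs. F (f xs) (g xs))"
proof -
  have "sigma_rel (Suc 2) (\<lambda>ys. hd ys = F (tl ys ! 0) (tl ys ! 1))"
  proof (rule sigma_rel_literal)
    fix vs :: "nat list"
    assume "length vs = Suc 2"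
    then obtain u v w where "vs = [w, u, v]" by (auto simp: length_Suc_conv numeral_2_eq_2)
    moreover obtain \<phi> where "crisp \<phi>" "delta0 \<phi>" "free_vars \<phi> \<subseteq> {u, v, w}"
        "\<forall>e. sat e \<phi> \<longleftrightarrow> F (e u) (e v) = e w"
      using assms(1) by blast
    ultimately show "\<exists>\<phi>. crisp \<phi> \<and> delta0 \<phi> \<and> free_vars \<phi> \<subseteq> set vs \<and>
        (\<forall>e. sat e \<phi> \<longleftrightarrow> hd (map e vs) = F (tl (map e vs) ! 0) (tl (map e vs) ! 1))"
      by (intro exI[of _ \<phi>]) auto
  qed
  then have "sigma_fun (length [f, g]) (\<lambda>xs. F (xs ! 0) (xs ! 1))"
    unfolding sigma_fun_def by (simp add: numeral_2_eq_2)
  then have "sigma_fun n (\<lambda>xs. F (map (\<lambda>g. g xs) [f, g] ! 0) (map (\<lambda>g. g xs) [f, g] ! 1))"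
    by (rule sigma_fun_comp) (use assms(2,3) in auto)
  then show ?thesis by simp
qed

lemma sigma_fun_add: "sigma_fun n f \<Longrightarrow> sigma_fun n g \<Longrightarrow> sigma_fun n (\<lambda>xs. f xs + g xs)"
proof (rule sigma_fun_binary[where F = "(+)"])
  fix u v w
  show "\<exists>\<phi>. crisp \<phi> \<and> delta0 \<phi> \<and> free_vars \<phi> \<subseteq> {u, v, w} \<and> (\<forall>e. sat e \<phi> \<longleftrightarrow> e u + e v = e w)"
    by (rule exI[of _ "Add (Var u) (Var v) (Var w)"]) (auto intro: crisp.intros delta0.intros)
qed

lemma sigma_fun_mult: "sigma_fun n f \<Longrightarrow> sigma_fun n g \<Longrightarrow> sigma_fun n (\<lambda>xs. f xs * g xs)"
proof (rule sigma_fun_binary[where F = "(*)"])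
  fix u v w
  show "\<exists>\<phi>. crisp \<phi> \<and> delta0 \<phi> \<and> free_vars \<phi> \<subseteq> {u, v, w} \<and> (\<forall>e. sat e \<phi> \<longleftrightarrow> e u * e v = e w)"
    by (rule exI[of _ "Mul (Var u) (Var v) (Var w)"]) (auto intro: crisp.intros delta0.intros)
qed

section \<open>Recursive functions\<close>

definition beta :: "nat \<Rightarrow> nat \<Rightarrow> nat \<Rightarrow> nat" where
  "beta a b i = a mod Suc (Suc i * b)"

text \<open>Chinese remainder theorem for the moduli \<open>1 + (i + 1) * b\<close>, which are
  pairwise coprime and exceed the \<open>s i\<close> when \<open>b\<close> is a suitable
  factorial.\<close>

lemma beta_complete: "\<exists>a b. \<forall>i\<le>k. beta a b i = s i"
proof -
  \<comment> \<open>\<open>M\<close> exceeds every difference of indices, so that these divide its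
    factorial, and it is at least every \<open>s i\<close>, so that each \<open>s i\<close> is below
    its modulus.\<close>
  define M where "M = Suc k + (\<Sum>i\<le>k. s i)"
  define b where "b = (fact M :: nat)"
  let ?m = "\<lambda>i. Suc (Suc i * b)"
  have less: "s i < ?m i" if "i \<le> k" for i
  proof -
    have "s i \<le> (\<Sum>i\<le>k. s i)" using that by (intro member_le_sum) auto
    also have "\<dots> \<le> M" by (simp add: M_def)
    also have "\<dots> \<le> b" unfolding b_def by (rule fact_ge_self)
    finally show ?thesis by simp
  qed
  have aux: "coprime (?m i) (?m j)" if "i < j" "j \<le> k" for i j
  proof (rule coprimeI)
    fix d assume d: "d dvd ?m i" "d dvd ?m j"
    \<comment> \<open>A common divisor divides this difference and is coprime to \<open>b\<close>,
      hence divides \<open>j - i\<close> and therefore \<open>b\<close>; being coprime to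
      \<open>b\<close>, it is a unit.\<close>
    have "?m j - ?m i = (j - i) * b" by (simp add: diff_mult_distrib)
    then have 1: "d dvd (j - i) * b" using d dvd_diff_nat by metis
    have cop: "coprime (?m i) b"
      by (metis coprime_1_left coprime_Suc_left_nat coprime_commute coprime_mult_right_iff
          mult_Suc)
    then have "coprime d b" using d(1) coprime_divisors dvd_refl by blast
    then have "d dvd j - i" using 1 coprime_dvd_mult_left_iff by blast
    moreover have "j - i dvd b" unfolding b_def using that by (intro dvd_fact) (auto simp: M_def)
    ultimately have "d dvd b" by (rule dvd_trans)
    with cop d(1) show "is_unit d" using coprime_common_divisor by blast
  qed
  then have "\<forall>i\<in>{..k}. \<forall>j\<in>{..k}. i \<noteq> j \<longrightarrow> coprime (?m i) (?m j)"
    by (metis atMost_iff coprime_commute linorder_neqE_nat)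
  from chinese_remainder_nat[OF _ this, of s] obtain a where "\<forall>i\<in>{..k}. [a = s i] (mod ?m i)"
    by auto
  then have "\<forall>i\<le>k. beta a b i = s i"
    using less unfolding beta_def cong_def by (metis atMost_iff mod_less)
  then show ?thesis by blast
qed

text \<open>The quotient is the existential witness. A successor as divisor excludes division by
  zero.\<close>

lemma sigma_fun_mod:
  assumes "sigma_fun n f" "sigma_fun n g"
  shows "sigma_fun n (\<lambda>xs. f xs mod Suc (g xs))"
proof (rule sigma_fun_literal)
  let ?R = "\<lambda>ys. f (tl ys) = hd ys mod Suc (g (tl ys))"
  let ?Q = "\<lambda>zs. f (tl (tl zs)) = zs ! 0 * Suc (g (tl (tl zs))) + zs ! 1 \<and> zs ! 1 < Suc (g (tl (tl zs)))"
  have "sigma_rel (Suc (Suc n)) ?Q"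
    by (intro sigma_rel_and sigma_rel_eq sigma_rel_less sigma_fun_add sigma_fun_mult sigma_fun_Suc
        sigma_fun_tl sigma_fun_nth assms) auto
  then show "sigma_rel (Suc n) (\<lambda>ys. \<exists>q. ?Q (q # ys))" by (rule sigma_rel_ex)
  show "y = f xs mod Suc (g xs) \<longleftrightarrow> (\<exists>q. ?Q (q # y # xs))" for y xs
  proof
    assume "y = f xs mod Suc (g xs)"
    then have "?Q ((f xs div Suc (g xs)) # y # xs)"
      using div_mult_mod_eq[of "f xs" "Suc (g xs)"] by simp
    then show "\<exists>q. ?Q (q # y # xs)" by blast
  next
    assume "\<exists>q. ?Q (q # y # xs)"
    then obtain q where "f xs = q * Suc (g xs) + y" "y < Suc (g xs)" by auto
    then show "y = f xs mod Suc (g xs)" by (metis mod_less mod_mult_self3)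
  qed
qed

lemma sigma_fun_beta:
  "sigma_fun n f \<Longrightarrow> sigma_fun n g \<Longrightarrow> sigma_fun n h \<Longrightarrow> sigma_fun n (\<lambda>xs. beta (f xs) (g xs) (h xs))"
  unfolding beta_def by (intro sigma_fun_mod sigma_fun_mult sigma_fun_Suc)

text \<open>The values up to \<open>k\<close> are coded by one pair \<open>a\<close>,
  \<open>b\<close>. The bound \<open>i \<le> k\<close> with the escape \<open>i = k\<close> replaces
  \<open>i < k\<close> to fit the form of \<open>sigma_rel_ball\<close>.\<close>

lemma rec_nat_eq_iff_beta:
  "y = rec_nat c h k \<longleftrightarrow>
    (\<exists>b a. beta a b 0 = c \<and> (\<forall>i\<le>k. i = k \<or> beta a b (Suc i) = h i (beta a b i)) \<and> y = beta a b k)"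
proof
  assume "y = rec_nat c h k"
  moreover obtain a b where ab: "\<forall>i\<le>k. beta a b i = rec_nat c h i"
    using beta_complete by blast
  moreover have "beta a b (Suc i) = h i (beta a b i)" if "i \<le> k" "i \<noteq> k" for i
    using ab that by simp
  ultimately show "\<exists>b a. beta a b 0 = c \<and> (\<forall>i\<le>k. i = k \<or> beta a b (Suc i) = h i (beta a b i)) \<and>
      y = beta a b k"
    by (metis le0 order_refl rec_nat_0_imp)
next
  assume "\<exists>b a. beta a b 0 = c \<and> (\<forall>i\<le>k. i = k \<or> beta a b (Suc i) = h i (beta a b i)) \<and>
      y = beta a b k"
  then obtain a b where ab: "beta a b 0 = c" "\<And>i. i < k \<Longrightarrow> beta a b (Suc i) = h i (beta a b i)"
    "y = beta a b k" by (metis less_imp_le_nat less_irrefl_nat)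
  have "j \<le> k \<Longrightarrow> beta a b j = rec_nat c h j" for j
    by (induction j) (auto simp: ab Suc_le_eq)
  with ab show "y = rec_nat c h k" by simp
qed

lemma sigma_fun_rec_nat:
  assumes f: "sigma_fun n f" and g: "sigma_fun (n + 2) g"
  shows "sigma_fun (n + 1) (\<lambda>xs. rec_nat (f (tl xs)) (\<lambda>k r. g (k # r # tl xs)) (hd xs))"
proof (rule sigma_fun_literal)
  \<comment> \<open>The list \<open>zs\<close> is \<open>i # a # b # y # k # xs\<close> in \<open>?S\<close>, and its tail in \<open>?Q\<close>.\<close>
  let ?B = "\<lambda>j zs. beta (zs ! 1) (zs ! 2) (j zs)"
  let ?S = "\<lambda>zs. zs ! 0 = zs ! 4 \<or>
    ?B (\<lambda>zs. Suc (zs ! 0)) zs = g (map (\<lambda>g. g zs) [\<lambda>zs. zs ! 0, ?B (\<lambda>zs. zs ! 0)] @ drop 5 zs)"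
  have "sigma_fun (5 + n) (\<lambda>zs. g (map (\<lambda>g. g zs) [\<lambda>zs. zs ! 0, ?B (\<lambda>zs. zs ! 0)] @ drop 5 zs))"
    by (rule sigma_fun_comp_drop)
      (use g in \<open>auto intro!: sigma_fun_nth sigma_fun_beta simp: add.commute\<close>)
  then have S: "sigma_rel (Suc (4 + n)) ?S"
    by (intro sigma_rel_or sigma_rel_eq sigma_fun_beta sigma_fun_nth sigma_fun_Suc) auto
  have F: "sigma_fun (4 + n) (\<lambda>zs. f (map (\<lambda>g. g zs) [] @ drop 4 zs))"
    by (rule sigma_fun_comp_drop) (use f in auto)
  let ?Q = "\<lambda>zs. beta (zs ! 0) (zs ! 1) 0 = f (map (\<lambda>g. g zs) [] @ drop 4 zs) \<and>
    (\<forall>i\<le>zs ! 3. ?S (i # zs)) \<and> zs ! 2 = beta (zs ! 0) (zs ! 1) (zs ! 3)"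
  have "sigma_rel (4 + n) ?Q"
    by (intro sigma_rel_and sigma_rel_ball sigma_rel_eq sigma_fun_beta sigma_fun_nth
        sigma_fun_numeral S F) auto
  then have "sigma_rel (Suc (Suc (Suc (n + 1)))) ?Q" by (simp add: numeral_eq_Suc)
  then show "sigma_rel (Suc (n + 1)) (\<lambda>ys. \<exists>b a. ?Q (a # b # ys))"
    by (intro sigma_rel_ex)
  show "y = rec_nat (f (tl xs)) (\<lambda>k r. g (k # r # tl xs)) (hd xs) \<longleftrightarrow>
      (\<exists>b a. ?Q (a # b # y # xs))" if "length xs = n + 1" for y xs
    using that by (cases xs) (simp_all add: rec_nat_eq_iff_beta numeral_eq_Suc)
qed

text \<open>Minimality says that \<open>f\<close> is positive at all smaller arguments. Writing
  nonzero as \<open>0 < f\<close> avoids negation, under which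
  \<open>\<Sigma>\<^sub>1\<close>-relations are not closed.\<close>

lemma sigma_fun_Least:
  assumes f: "sigma_fun (n + 1) f" and ex: "\<forall>xs. length xs = n \<longrightarrow> (\<exists>k. f (k # xs) = 0)"
  shows "sigma_fun n (\<lambda>xs. LEAST k. f (k # xs) = 0)"
proof (rule sigma_fun_literal)
  \<comment> \<open>The list \<open>zs\<close> will be \<open>i # y # xs\<close>, so
    \<open>?f zs\<close> is \<open>f (i # xs)\<close>.\<close>
  let ?f = "\<lambda>zs. f (map (\<lambda>g. g zs) [\<lambda>zs. zs ! 0] @ drop 2 zs)"
  have "sigma_fun (2 + n) ?f"
    by (rule sigma_fun_comp_drop) (use f in \<open>auto intro: sigma_fun_nth\<close>)
  then have "sigma_rel (2 + n) (\<lambda>zs. zs ! 0 = zs ! 1 \<or> 0 < ?f zs)"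
    by (intro sigma_rel_or sigma_rel_eq sigma_rel_less sigma_fun_nth sigma_fun_numeral) auto
  then have "sigma_rel (Suc n) (\<lambda>ys. \<forall>i\<le>ys ! 0. (i # ys) ! 0 = (i # ys) ! 1 \<or> 0 < ?f (i # ys))"
    by (intro sigma_rel_ball) (auto simp: numeral_2_eq_2)
  then show "sigma_rel (Suc n) (\<lambda>ys. f ys = 0 \<and>
      (\<forall>i\<le>ys ! 0. (i # ys) ! 0 = (i # ys) ! 1 \<or> 0 < ?f (i # ys)))"
    using f by (intro sigma_rel_and sigma_rel_eq sigma_fun_numeral) auto
  show "y = (LEAST k. f (k # xs) = 0) \<longleftrightarrow> f (y # xs) = 0 \<and>
      (\<forall>i\<le>(y # xs) ! 0. (i # y # xs) ! 0 = (i # y # xs) ! 1 \<or> 0 < ?f (i # y # xs))"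
    if "length xs = n" for y xs
  proof -
    have "y = (LEAST k. f (k # xs) = 0) \<longleftrightarrow> f (y # xs) = 0 \<and> (\<forall>i<y. f (i # xs) \<noteq> 0)"
    proof
      assume "y = (LEAST k. f (k # xs) = 0)"
      then show "f (y # xs) = 0 \<and> (\<forall>i<y. f (i # xs) \<noteq> 0)"
        using ex that by (metis (mono_tags, lifting) LeastI_ex not_less_Least)
    next
      assume "f (y # xs) = 0 \<and> (\<forall>i<y. f (i # xs) \<noteq> 0)"
      then show "y = (LEAST k. f (k # xs) = 0)"
        by (intro Least_equality[symmetric]) (auto simp: not_less[symmetric])
    qed
    also have "\<dots> \<longleftrightarrow> f (y # xs) = 0 \<and> (\<forall>i\<le>y. i = y \<or> 0 < f (i # xs))"
      by (auto simp: le_less)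
    finally show ?thesis by simp
  qed
qed

lemma rec_fun_sigma_fun: "rec_fun n f \<Longrightarrow> sigma_fun n f"
proof (induction rule: rec_fun.induct)
  case (zero n)
  show ?case by (rule sigma_fun_numeral)
next
  case succ
  show ?case by (intro sigma_fun_Suc sigma_fun_nth) simp
next
  case (proj i n)
  then show ?case by (rule sigma_fun_nth)
next
  case (comp gs f n)
  then show ?case by (intro sigma_fun_comp) auto
next
  case (prim_rec n f g)
  then show ?case by (intro sigma_fun_rec_nat)
next
  case (minimisation n f)
  then show ?case by (intro sigma_fun_Least)
qed

section \<open>Codes of pairs, numerals and diagonal sentences\<close>

lemma sigma_fun_prod_encode:
  assumes "sigma_fun n f" "sigma_fun n g"
  shows "sigma_fun n (\<lambda>xs. prod_encode (f xs, g xs))"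
proof (rule sigma_fun_literal)
  let ?s = "\<lambda>ys. f (tl ys) + g (tl ys)"
  \<comment> \<open>\<open>prod_encode (a, b)\<close> is the triangular number of
    \<open>a + b\<close> plus \<open>a\<close>; doubling removes the division by two.\<close>
  show "sigma_rel (Suc n) (\<lambda>ys. ys ! 0 + ys ! 0 = ?s ys * Suc (?s ys) + (f (tl ys) + f (tl ys)))"
    by (intro sigma_rel_eq sigma_fun_add sigma_fun_mult sigma_fun_Suc sigma_fun_tl sigma_fun_nth
        assms) auto
  have *: "2 * triangle k = k * Suc k" for k by (simp add: triangle_def)
  show "y = prod_encode (f xs, g xs) \<longleftrightarrow> (y # xs) ! 0 + (y # xs) ! 0 =
      ?s (y # xs) * Suc (?s (y # xs)) + (f (tl (y # xs)) + f (tl (y # xs)))" for y xs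
    unfolding prod_encode_def using *[of "f xs + g xs"] by auto
qed

lemma sigma_fun_numeral_code: "sigma_fun 1 (\<lambda>xs. tm_code (numeral_tm (xs ! 0)))"
proof -
  have "tm_code (numeral_tm k) = rec_nat (prod_encode (1, 0)) (\<lambda>k r. prod_encode (2, r)) k" for k
    by (induction k) auto
  moreover have "sigma_fun (0 + 1) (\<lambda>xs. rec_nat ((\<lambda>xs. prod_encode (1, 0)) (tl xs))
      (\<lambda>k r. (\<lambda>zs. prod_encode (2, zs ! 1)) (k # r # tl xs)) (hd xs))"
    by (rule sigma_fun_rec_nat) (intro sigma_fun_prod_encode sigma_fun_numeral sigma_fun_nth, simp)+
  ultimately have "sigma_fun 1 (\<lambda>xs. tm_code (numeral_tm (hd xs)))" by simp
  then show ?thesis by (subst sigma_fun_cong) (auto simp: length_Suc_conv)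
qed

text \<open>Turns the defining formula into a predicate \<open>P\<close> of two numbers, so that the
  diagonal argument can reason about witnesses without assignments.\<close>

lemma sigma_rel_unary:
  assumes "sigma_rel 1 R" "w \<noteq> x"
  obtains \<phi> P where "crisp \<phi>" "delta0 \<phi>" "free_vars \<phi> \<subseteq> {x, w}"
    "\<And>e. sat e \<phi> \<longleftrightarrow> P (e x) (e w)"
    "\<And>n k l. P n k \<Longrightarrow> k \<le> l \<Longrightarrow> P n l" "\<And>n. R [n] \<longleftrightarrow> (\<exists>k. P n k)"
proof -
  obtain \<phi> where "sigma_formula [x] w R \<phi>"
    using sigma_relD[OF assms(1), of "[x]" w] assms(2) by auto
  note \<phi> = sigma_formulaD[OF this]
  define P where "P n k \<longleftrightarrow> sat ((\<lambda>_. n)(w := k)) \<phi>" for n k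
  show ?thesis
  proof
    show "sat e \<phi> \<longleftrightarrow> P (e x) (e w)" for e
      unfolding P_def by (rule sat_cong) (use \<phi>(3) in auto)
    show "free_vars \<phi> \<subseteq> {x, w}" using \<phi>(3) by auto
    show "R [n] \<longleftrightarrow> (\<exists>k. P n k)" for n
      using \<phi>(5)[of "\<lambda>_. n"] unfolding P_def by simp
    show "P n l" if "P n k" "k \<le> l" for n k l
      using \<phi>(4) that unfolding P_def by blast
  qed (rule \<phi>)+
qed


section \<open>The diagonal sentence\<close>

text \<open>\<open>diag_matrix \<gamma> c\<close> plays the role of \<open>\<gamma>(c, y)\<close>, where \<open>x = Var 0\<close> and \<open>y = Var 1\<close>, but its code
  is a simple function of the code of \<open>\<gamma>\<close>. The disjunct \<open>y \<le> c\<close> makes up for the bound on \<open>x\<close>.\<close>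

definition diag_matrix :: "fm \<Rightarrow> nat \<Rightarrow> fm" where
  "diag_matrix \<gamma> c =
     Or (Le (Var 1) (numeral_tm c)) (BEx 0 1 (And (Eq (Var 0) (numeral_tm c)) \<gamma>))"

definition diag :: "fm \<Rightarrow> nat \<Rightarrow> fm" where
  "diag \<gamma> c = Ex 1 (Neg (diag_matrix \<gamma> c))"

text \<open>\<open>diag\<close> places \<gamma> and the numeral of its code into a fixed frame
  without substituting into \<gamma>, so its code arises by pairing from the code of \<gamma> and
  the code of that numeral.\<close>

lemma sigma_fun_diag_code:
  "\<exists>s. sigma_fun 1 (\<lambda>xs. s (xs ! 0)) \<and> (\<forall>\<gamma>. fm_code (diag \<gamma> (fm_code \<gamma>)) = s (fm_code \<gamma>))"
proof -
  define N where "N xs = tm_code (numeral_tm (xs ! 0))" for xs :: "nat list"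
  have N: "sigma_fun 1 N" unfolding N_def by (rule sigma_fun_numeral_code)
  \<comment> \<open>In tag position, 9, 5, 7, 1, 6 and 0 stand for \<open>Ex\<close>,
    \<open>Imp\<close>, \<open>Or\<close>, \<open>Le\<close>, \<open>And\<close> and
    \<open>Eq\<close>; the entry \<open>xs ! 0\<close> is the code of \<gamma>.\<close>
  let ?s = "\<lambda>xs. prod_encode (9, prod_encode (1, prod_encode (5, prod_encode (prod_encode (7,
    prod_encode (prod_encode (1, prod_encode (tm_code (Var 1), N xs)),
      prod_encode (9, prod_encode (0, prod_encode (6, prod_encode (fm_code (Le (Var 0) (Var 1)),
        prod_encode (6, prod_encode (prod_encode (0, prod_encode (tm_code (Var 0), N xs)),
          xs ! 0)))))))), fm_code Bot))))"
  have "sigma_fun 1 ?s"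
    by (intro sigma_fun_prod_encode N sigma_fun_numeral sigma_fun_nth) simp
  moreover have "?s xs = ?s [xs ! 0]" for xs by (simp add: N_def)
  ultimately have "sigma_fun 1 (\<lambda>xs. ?s [xs ! 0])" by simp
  moreover have "fm_code (diag \<gamma> (fm_code \<gamma>)) = ?s [fm_code \<gamma>]" for \<gamma>
    by (simp add: diag_def diag_matrix_def N_def)
  ultimately show ?thesis by (intro exI[of _ "\<lambda>c. ?s [c]"]) blast
qed

lemma R_tilde_extension_undecidable:
  assumes con: "sigma1_consistent T" and R: "strengthens T R_tilde"
  shows "\<not> decidable_theory T"
proof
  assume "decidable_theory T"
  then obtain f where f: "rec_fun 1 f" "\<And>\<phi>. f [fm_code \<phi>] = (if T \<turnstile> \<phi> then 1 else 0)"
    unfolding decidable_theory_def recursive_set_def consequences_def by (auto simp: image_iff)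
  interpret R_theory T
    using R by unfold_locales (auto simp: strengthens_def consequences_def)
  obtain s where s: "sigma_fun 1 (\<lambda>xs. s (xs ! 0))"
    "\<And>\<gamma>. fm_code (diag \<gamma> (fm_code \<gamma>)) = s (fm_code \<gamma>)"
    using sigma_fun_diag_code by blast
  have "sigma_fun 1 (\<lambda>xs. f (map (\<lambda>g. g xs) [\<lambda>xs. s (xs ! 0)]))"
    by (rule sigma_fun_comp) (use s rec_fun_sigma_fun[OF f(1)] in auto)
  then have sf: "sigma_rel 1 (\<lambda>xs. f [s (xs ! 0)] = i)" for i
    by (intro sigma_rel_eq sigma_fun_numeral) simp
  \<comment> \<open>Witnesses for \<open>P\<close> attest the value 0 of \<open>f\<close>, that is,
    unprovability of the diagonal sentence; those for \<open>Q\<close> below attest the value 1,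
    that is, provability.\<close>
  obtain \<phi> P where \<phi>: "crisp \<phi>" "delta0 \<phi>" "free_vars \<phi> \<subseteq> {0, 1}"
    "\<And>e. sat e \<phi> \<longleftrightarrow> P (e 0) (e 1)" "\<And>n k l. P n k \<Longrightarrow> k \<le> l \<Longrightarrow> P n l"
    "\<And>n. f [s ([n] ! 0)] = 0 \<longleftrightarrow> (\<exists>k. P n k)"
    by (rule sigma_rel_unary[OF sf[of 0] one_neq_zero]) (rule that)
  obtain \<psi> Q where \<psi>: "crisp \<psi>" "delta0 \<psi>" "free_vars \<psi> \<subseteq> {0, 2}"
    "\<And>e. sat e \<psi> \<longleftrightarrow> Q (e 0) (e 2)" "\<And>n k l. Q n k \<Longrightarrow> k \<le> l \<Longrightarrow> Q n l"
    "\<And>n. f [s ([n] ! 0)] = 1 \<longleftrightarrow> (\<exists>k. Q n k)"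
    by (rule sigma_rel_unary[OF sf[of 1], of 2 0], simp) (rule that)
  \<comment> \<open>Negated, \<gamma> says that \<open>y\<close> witnesses unprovability and that no
    \<open>z \<le> y\<close> witnesses provability.\<close>
  define \<gamma> where "\<gamma> = Or (BEx 2 1 \<psi>) (Neg \<phi>)"
  define c where "c = fm_code \<gamma>"
  have fc: "f [s c] = (if T \<turnstile> diag \<gamma> c then 1 else 0)"
    unfolding c_def s(2)[symmetric] f(2) ..
  have PQ: "(\<exists>k. P c k) \<longleftrightarrow> \<not> T \<turnstile> diag \<gamma> c" "(\<exists>k. Q c k) \<longleftrightarrow> T \<turnstile> diag \<gamma> c"
    using fc \<phi>(6)[of c] \<psi>(6)[of c] by auto
  have \<gamma>: "crisp \<gamma>" "delta0 \<gamma>" "free_vars \<gamma> \<subseteq> {0, 1}"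
    "sat e \<gamma> \<longleftrightarrow> (\<exists>z\<le>e 1. Q (e 0) z) \<or> \<not> P (e 0) (e 1)" for e
    unfolding \<gamma>_def using \<phi>(1-4) \<psi>(1-4) by (auto intro!: crisp.intros delta0.intros)
  have G: "crisp (diag_matrix \<gamma> c)" "delta0 (diag_matrix \<gamma> c)" "free_vars (diag_matrix \<gamma> c) \<subseteq> {1}"
    unfolding diag_matrix_def using \<gamma>(1-3) by (auto intro!: crisp.intros delta0.intros)
  have satG: "sat e (diag_matrix \<gamma> c) \<longleftrightarrow>
      e 1 \<le> c \<or> (\<exists>z\<le>e 1. Q c z) \<or> \<not> P c (e 1)" for e
    unfolding diag_matrix_def by (auto simp: \<gamma>(4))
  show False
  proof (cases "T \<turnstile> diag \<gamma> c")
    case False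
    then obtain k where "P c k" using PQ(1) by blast
    \<comment> \<open>Monotonicity raises the witness above \<open>c\<close>, which falsifies the
      disjunct \<open>y \<le> c\<close>.\<close>
    then have "P c (max k (Suc c))" using \<phi>(5) max.cobounded1 by blast
    moreover have "\<not> Q c z" for z using PQ(2) False by blast
    ultimately have "sat e (subst (Neg (diag_matrix \<gamma> c)) 1 (numeral_tm (max k (Suc c))))" for e
      by (simp add: sat_subst substitutable_closed satG)
    then have "T \<turnstile> subst (Neg (diag_matrix \<gamma> c)) 1 (numeral_tm (max k (Suc c)))"
      using G by (intro crisp_true crisp_subst crisp_Neg) (auto simp: free_vars_subst_closed)
    then have "T \<turnstile> diag \<gamma> c"
      unfolding diag_def by (rule modus_ponens) (rule ex_inst, simp add: substitutable_closed)
    with False show False ..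
  next
    case True
    then obtain q where q: "Q c q" using PQ(2) by blast
    have nP: "\<not> P c k" for k using PQ(1) True by blast
    let ?c = "numeral_tm c" and ?q = "numeral_tm q"
    let ?H = "subst \<gamma> 0 ?c"
    have H_eq: "?H = Or (BEx 2 1 (subst \<psi> 0 ?c)) (Neg (subst \<phi> 0 ?c))"
      by (simp add: \<gamma>_def)
    have "T \<turnstile> Imp (Le (Var 1) ?q) ?H"
    proof (rule bounded_cases)
      fix i
      \<comment> \<open>\<open>P c\<close> has no witness, so the second disjunct of
        \<open>?H\<close> is true at every numeral.\<close>
      have "sat (\<lambda>_. 0) (subst ?H 1 (numeral_tm i))"
        by (simp add: sat_subst substitutable_closed \<gamma>(4) nP)
      then show "T \<turnstile> subst ?H 1 (numeral_tm i)"
        using \<gamma>(1,3) by (intro crisp_true crisp_subst) (auto simp: free_vars_subst_closed)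
    qed
    \<comment> \<open>Here \<open>y\<close> has no upper bound, so \<open>?H\<close> cannot be
      reduced to finitely many instances. Instead \<open>q\<close> is supplied as the witness of the
      inner quantifier, whose bound is exactly the premise \<open>q \<le> y\<close>.\<close>
    moreover have "T \<turnstile> Imp (Le ?q (Var 1)) ?H"
    proof -
      have "sat (\<lambda>_. 0) (subst (subst \<psi> 0 ?c) 2 ?q)"
        by (simp add: sat_subst substitutable_closed \<psi>(4) q)
      then have "T \<turnstile> subst (subst \<psi> 0 ?c) 2 ?q"
        using \<psi>(1,3) by (intro crisp_true crisp_subst) (auto simp: free_vars_subst_closed)
      then have "T \<turnstile> Imp (Le ?q (Var 1)) (subst (And (Le (Var 2) (Var 1)) (subst \<psi> 0 ?c)) 2 ?q)"
        by (simp add: and_intro imp_refl weakening)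
      moreover have "T \<turnstile> Imp (subst (And (Le (Var 2) (Var 1)) (subst \<psi> 0 ?c)) 2 ?q)
          (BEx 2 1 (subst \<psi> 0 ?c))"
        by (rule ex_inst) (simp add: substitutable_closed)
      ultimately show ?thesis
        unfolding H_eq by (meson transitivity or_left)
    qed
    ultimately have H: "T \<turnstile> ?H"
      by (meson R_axiom R_tilde.le_linear modus_ponens or_elim)
    \<comment> \<open>The witness for the bounded quantifier is \<open>x = c\<close>, whose bound is
      the premise \<open>c \<le> y\<close>; the case \<open>y \<le> c\<close> is the other disjunct
      of \<open>diag_matrix\<close>.\<close>
    have "T \<turnstile> Imp (Le ?c (Var 1))
        (subst (And (Le (Var 0) (Var 1)) (And (Eq (Var 0) ?c) \<gamma>)) 0 ?c)"
      using H by (simp add: and_intro imp_refl weakening conjunction eq_refl_numeral)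
    moreover have "T \<turnstile> Imp (subst (And (Le (Var 0) (Var 1)) (And (Eq (Var 0) ?c) \<gamma>)) 0 ?c)
        (BEx 0 1 (And (Eq (Var 0) ?c) \<gamma>))"
      by (rule ex_inst) (simp add: substitutable_closed)
    ultimately have "T \<turnstile> Imp (Le ?c (Var 1)) (diag_matrix \<gamma> c)"
      unfolding diag_matrix_def by (meson transitivity or_right)
    then have "T \<turnstile> diag_matrix \<gamma> c"
      unfolding diag_matrix_def
      by (meson R_axiom R_tilde.le_linear modus_ponens or_elim or_left)
    then have "T \<turnstile> Neg (Neg (diag_matrix \<gamma> c))" by (rule assertion)
    \<comment> \<open>The double negation is an implication from the matrix of
      \<open>diag \<gamma> c\<close> to the closed formula \<open>Bot\<close>, so its premise may be
      quantified existentially.\<close>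
    then have "T \<turnstile> Neg (diag \<gamma> c)" unfolding diag_def by (rule ex_gen) simp
    moreover have "sigma1 (diag \<gamma> c)"
      unfolding sigma1_def diag_def using G(2) by (blast intro: delta0.intros)
    ultimately show False using con True unfolding sigma1_consistent_def by blast
  qed
qed

theorem mainTheorem1:
  shows "sigma1_consistent R_tilde \<and>
    (\<forall>T. sigma1_consistent T \<and> strengthens T R_tilde \<longrightarrow> \<not> decidable_theory T)"
  using R_tilde_sigma1_consistent R_tilde_extension_undecidable by blast

end
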